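(* Let $A$ be a Marot ring. If $A$ is an ISP-ring in which every regular prime ideal is maximal, then $A$ is an $N$-ring.
   Context: All rings are commutative with a nonzero unit. An element of a ring is regular if it is not a zero-divisor; an ideal is regular if it contains at least one regular element. A ring is Marot if each of its regular ideals is generated by regular elements. A proper ideal $H$ is a radical ideal if $\sqrt H=H$. An ideal $J$ of $A$ is invertible if $JJ'=A$ for some $A$-submodule $J'$ of the total quotient ring $T(A)$; equivalently, $J$ is finitely generated, regular, and $J_M$ is a principal ideal of $A_M$ for each maximal ideal $M$ of $A$ (the ideal $A$ itself is allowed). A ring is an ISP-ring if every proper regular ideal of it can be written as $JH_1\cdots H_n$ with $J$ an invertible ideal, $n\ge 1$, and all $H_i$ proper radical ideals. For a prime ideal $P$ of $A$, $A_{(P)}=\{a/b\in T(A) : a\in A,\ b\in A\setminus P,\ b \text{ regular}\}$. A Manis valuation on a ring $T$ is a surjective map $v:T\to G\cup\{\infty\}$, with $G$ a totally ordered abelian group, such that $v(xy)=v(x)+v(y)$, $v(x+y)\ge\min\{v(x),v(y)\}$, $v(1)=0$ and $v(0)=\infty$. A ring $R$ with total quotient ring $T$ is a discrete rank one Manis valuation ring if $R=\{x\in T : v(x)\ge 0\}$ for some Manis valuation $v$ on $T$ with $G\cong\mathbb Z$. A ring $A$ is an $N$-ring if $A_{(M)}$ is a discrete rank one Manis valuation ring for each regular maximal ideal $M$ of $A$. *)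

theory Defs
  imports "HOL-Algebra.Module" "HOL-Algebra.Ideal_Product" "HOL-Library.Extended"
begin

definition nonzero_cring :: "('a, 'm) ring_scheme \<Rightarrow> bool" where
  "nonzero_cring R \<longleftrightarrow> cring R \<and> \<one>\<^bsub>R\<^esub> \<noteq> \<zero>\<^bsub>R\<^esub>"

section \<open>Regular elements and regular ideals\<close>

definition regular_elements :: "('a, 'm) ring_scheme \<Rightarrow> 'a set" where
  "regular_elements R =
    {a \<in> carrier R. \<forall>x \<in> carrier R. a \<otimes>\<^bsub>R\<^esub> x = \<zero>\<^bsub>R\<^esub> \<longrightarrow> x = \<zero>\<^bsub>R\<^esub>}"

definition regular_ideal :: "'a set \<Rightarrow> ('a, 'm) ring_scheme \<Rightarrow> bool" where
  "regular_ideal I R \<longleftrightarrow> ideal I R \<and> I \<inter> regular_elements R \<noteq> {}"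

definition marot_ring :: "('a, 'm) ring_scheme \<Rightarrow> bool" where
  "marot_ring R \<longleftrightarrow>
    (\<forall>I. regular_ideal I R \<longrightarrow> (\<exists>S \<subseteq> regular_elements R. I = Idl\<^bsub>R\<^esub> S))"

section \<open>The total quotient ring\<close>

definition fraction_rel :: "('a, 'm) ring_scheme \<Rightarrow> (('a \<times> 'a) \<times> ('a \<times> 'a)) set" where
  "fraction_rel R = {((a, b), (c, d)).
    a \<in> carrier R \<and> b \<in> regular_elements R \<and> c \<in> carrier R \<and> d \<in> regular_elements R \<and>
    a \<otimes>\<^bsub>R\<^esub> d = c \<otimes>\<^bsub>R\<^esub> b}"

definition fraction :: "('a, 'm) ring_scheme \<Rightarrow> 'a \<Rightarrow> 'a \<Rightarrow> ('a \<times> 'a) set" where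
  "fraction R a b = fraction_rel R `` {(a, b)}"

text \<open>
  The total quotient ring is a record of type \<open>module\<close>: apart from its ring structure it
  carries the scalar action of \<open>R\<close>, so that \<open>R\<close>-submodules of it can be expressed by the
  library predicate \<open>submodule\<close>.
  Each union below ranges over all representatives of the arguments; the lemmas
  \<open>fraction_add\<close>, \<open>fraction_mult\<close> and \<open>fraction_smult\<close> show that it is a single class.
\<close>

definition total_quotient_ring ::
    "('a, 'm) ring_scheme \<Rightarrow> ('a, ('a \<times> 'a) set) module" where
  "total_quotient_ring R =
    \<lparr>carrier = (carrier R \<times> regular_elements R) // fraction_rel R,
     mult = (\<lambda>U V. \<Union>(a, b) \<in> U. \<Union>(c, d) \<in> V. fraction R (a \<otimes>\<^bsub>R\<^esub> c) (b \<otimes>\<^bsub>R\<^esub> d)),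
     one = fraction R \<one>\<^bsub>R\<^esub> \<one>\<^bsub>R\<^esub>,
     zero = fraction R \<zero>\<^bsub>R\<^esub> \<one>\<^bsub>R\<^esub>,
     add = (\<lambda>U V. \<Union>(a, b) \<in> U. \<Union>(c, d) \<in> V.
              fraction R (a \<otimes>\<^bsub>R\<^esub> d \<oplus>\<^bsub>R\<^esub> c \<otimes>\<^bsub>R\<^esub> b) (b \<otimes>\<^bsub>R\<^esub> d)),
     smult = (\<lambda>r U. \<Union>(c, d) \<in> U. fraction R (r \<otimes>\<^bsub>R\<^esub> c) d)\<rparr>"

definition to_quotient :: "('a, 'm) ring_scheme \<Rightarrow> 'a \<Rightarrow> ('a \<times> 'a) set" where
  "to_quotient R a = fraction R a \<one>\<^bsub>R\<^esub>"

lemma regular_elements_closed: "a \<in> regular_elements R \<Longrightarrow> a \<in> carrier R"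
  by (simp add: regular_elements_def)

lemma UN_pair_const:
  assumes "p \<in> U" "\<And>a b. (a, b) \<in> U \<Longrightarrow> F a b = K"
  shows "(\<Union>(a, b) \<in> U. F a b) = K"
proof -
  have "(case q of (a, b) \<Rightarrow> F a b) = K" if "q \<in> U" for q
    using that assms(2) by (cases q) simp
  then have "(\<Union>q \<in> U. case q of (a, b) \<Rightarrow> F a b) = (\<Union>q \<in> U. K)"
    by (intro SUP_cong) auto
  also have "\<dots> = K"
    using assms(1) by blast
  finally show ?thesis .
qed

context cring
begin

lemma regular_cancel:
  assumes "a \<in> regular_elements R" "x \<in> carrier R" "y \<in> carrier R" "a \<otimes> x = a \<otimes> y"
  shows "x = y"
proof -
  have a: "a \<in> carrier R"
    using assms(1) by (rule regular_elements_closed)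
  have "a \<otimes> (x \<oplus> \<ominus> y) = a \<otimes> x \<oplus> \<ominus> (a \<otimes> y)"
    using a assms(2,3) by (simp add: r_distr r_minus)
  also have "\<dots> = \<zero>"
    using a assms(3) by (simp add: assms(4) r_neg)
  finally have "x \<oplus> \<ominus> y = \<zero>"
    using assms(1-3) by (simp add: regular_elements_def)
  then show ?thesis
    using assms(2,3) minus_equality[of x "\<ominus> y"] by simp
qed

lemma one_regular: "\<one> \<in> regular_elements R"
  by (simp add: regular_elements_def)

lemma mult_regular:
  assumes "a \<in> regular_elements R" "b \<in> regular_elements R"
  shows "a \<otimes> b \<in> regular_elements R"
proof -
  have c: "a \<in> carrier R" "b \<in> carrier R"
    using assms by (simp_all add: regular_elements_closed)
  have "x = \<zero>" if x: "x \<in> carrier R" "a \<otimes> b \<otimes> x = \<zero>" for x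
  proof -
    have "a \<otimes> (b \<otimes> x) = \<zero>"
      using c x by (simp only: m_assoc[symmetric])
    then have "b \<otimes> x = \<zero>"
      using assms(1) c x(1) by (simp add: regular_elements_def)
    then show ?thesis
      using assms(2) x(1) by (simp add: regular_elements_def)
  qed
  then show ?thesis
    using c by (simp add: regular_elements_def)
qed

lemma fraction_rel_equiv: "equiv (carrier R \<times> regular_elements R) (fraction_rel R)"
proof (intro equivI)
  show "fraction_rel R \<subseteq> (carrier R \<times> regular_elements R) \<times> (carrier R \<times> regular_elements R)"
    by (auto simp: fraction_rel_def)
  show "refl_on (carrier R \<times> regular_elements R) (fraction_rel R)"
    by (auto simp: refl_on_def fraction_rel_def)
  show "sym (fraction_rel R)"
    by (auto simp: sym_def fraction_rel_def)
  show "trans (fraction_rel R)"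
  proof (rule transI, clarsimp simp: fraction_rel_def)
    fix a b c d e f
    assume c: "a \<in> carrier R" "b \<in> regular_elements R" "c \<in> carrier R" "d \<in> regular_elements R"
      "e \<in> carrier R" "f \<in> regular_elements R"
      and e: "a \<otimes> d = c \<otimes> b" "c \<otimes> f = e \<otimes> d"
    note cl = c c(2,4,6)[THEN regular_elements_closed]
    have "d \<otimes> (a \<otimes> f) = (a \<otimes> d) \<otimes> f" using cl by (simp add: m_ac)
    also have "\<dots> = (c \<otimes> f) \<otimes> b" using cl e by (simp add: m_ac)
    also have "\<dots> = d \<otimes> (e \<otimes> b)" using cl e by (simp add: m_ac)
    finally show "a \<otimes> f = e \<otimes> b"
      using cl regular_cancel[OF c(4)] by simp
  qed
qed

lemma fraction_eq_iff:
  assumes "a \<in> carrier R" "b \<in> regular_elements R" "c \<in> carrier R" "d \<in> regular_elements R"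
  shows "fraction R a b = fraction R c d \<longleftrightarrow> a \<otimes> d = c \<otimes> b"
  unfolding fraction_def using eq_equiv_class_iff[OF fraction_rel_equiv, of "(a, b)" "(c, d)"] assms
  by (auto simp: fraction_rel_def)

lemma mem_fraction_iff:
  assumes "a \<in> carrier R" "b \<in> regular_elements R"
  shows "(c, d) \<in> fraction R a b \<longleftrightarrow>
    c \<in> carrier R \<and> d \<in> regular_elements R \<and> a \<otimes> d = c \<otimes> b"
  using assms by (auto simp: fraction_def fraction_rel_def)

lemma fraction_self:
  assumes "a \<in> carrier R" "b \<in> regular_elements R"
  shows "(a, b) \<in> fraction R a b"
  using assms by (simp add: mem_fraction_iff)

lemma fraction_closed:
  assumes "a \<in> carrier R" "b \<in> regular_elements R"
  shows "fraction R a b \<in> carrier (total_quotient_ring R)"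
  using assms by (auto simp: total_quotient_ring_def fraction_def intro: quotientI)

lemma carrier_total_quotient_ring:
  "carrier (total_quotient_ring R) =
    {fraction R a b | a b. a \<in> carrier R \<and> b \<in> regular_elements R}"
  by (auto simp: total_quotient_ring_def fraction_def quotient_def)

lemma fraction_mult:
  assumes "a \<in> carrier R" "b \<in> regular_elements R" "c \<in> carrier R" "d \<in> regular_elements R"
  shows "fraction R a b \<otimes>\<^bsub>total_quotient_ring R\<^esub> fraction R c d = fraction R (a \<otimes> c) (b \<otimes> d)"
proof -
  have "fraction R (a' \<otimes> c') (b' \<otimes> d') = fraction R (a \<otimes> c) (b \<otimes> d)"
    if "(a', b') \<in> fraction R a b" "(c', d') \<in> fraction R c d" for a' b' c' d'
  proof -
    have r: "a' \<in> carrier R" "b' \<in> regular_elements R" "a \<otimes> b' = a' \<otimes> b"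
      "c' \<in> carrier R" "d' \<in> regular_elements R" "c \<otimes> d' = c' \<otimes> d"
      using that assms by (simp_all add: mem_fraction_iff)
    note cl = assms r(1,2,4,5) assms(2,4)[THEN regular_elements_closed]
      r(2,5)[THEN regular_elements_closed]
    have "a' \<otimes> c' \<otimes> (b \<otimes> d) = (a' \<otimes> b) \<otimes> (c' \<otimes> d)" using cl by (simp add: m_ac)
    also have "\<dots> = (a \<otimes> b') \<otimes> (c \<otimes> d')" by (simp only: r)
    also have "\<dots> = a \<otimes> c \<otimes> (b' \<otimes> d')" using cl by (simp add: m_ac)
    finally show ?thesis
      using cl by (simp add: fraction_eq_iff mult_regular)
  qed
  then show ?thesis
    unfolding total_quotient_ring_def monoid.simps ring.simps
    by (intro UN_pair_const[OF fraction_self[OF assms(1,2)]]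
        UN_pair_const[OF fraction_self[OF assms(3,4)]])
qed

lemma fraction_add:
  assumes "a \<in> carrier R" "b \<in> regular_elements R" "c \<in> carrier R" "d \<in> regular_elements R"
  shows "fraction R a b \<oplus>\<^bsub>total_quotient_ring R\<^esub> fraction R c d =
    fraction R (a \<otimes> d \<oplus> c \<otimes> b) (b \<otimes> d)"
proof -
  have "fraction R (a' \<otimes> d' \<oplus> c' \<otimes> b') (b' \<otimes> d') = fraction R (a \<otimes> d \<oplus> c \<otimes> b) (b \<otimes> d)"
    if "(a', b') \<in> fraction R a b" "(c', d') \<in> fraction R c d" for a' b' c' d'
  proof -
    have r: "a' \<in> carrier R" "b' \<in> regular_elements R" "a \<otimes> b' = a' \<otimes> b"
      "c' \<in> carrier R" "d' \<in> regular_elements R" "c \<otimes> d' = c' \<otimes> d"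
      using that assms by (simp_all add: mem_fraction_iff)
    note cl = assms r(1,2,4,5) assms(2,4)[THEN regular_elements_closed]
      r(2,5)[THEN regular_elements_closed]
    have "(a' \<otimes> d' \<oplus> c' \<otimes> b') \<otimes> (b \<otimes> d) =
        (a' \<otimes> b) \<otimes> (d \<otimes> d') \<oplus> (c' \<otimes> d) \<otimes> (b \<otimes> b')"
      using cl by algebra
    also have "\<dots> = (a \<otimes> b') \<otimes> (d \<otimes> d') \<oplus> (c \<otimes> d') \<otimes> (b \<otimes> b')" by (simp only: r)
    also have "\<dots> = (a \<otimes> d \<oplus> c \<otimes> b) \<otimes> (b' \<otimes> d')"
      using cl by algebra
    finally show ?thesis
      using cl by (simp add: fraction_eq_iff mult_regular)
  qed
  then show ?thesis
    unfolding total_quotient_ring_def monoid.simps ring.simps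
    by (intro UN_pair_const[OF fraction_self[OF assms(1,2)]]
        UN_pair_const[OF fraction_self[OF assms(3,4)]])
qed

lemma fraction_smult:
  assumes "r \<in> carrier R" "c \<in> carrier R" "d \<in> regular_elements R"
  shows "r \<odot>\<^bsub>total_quotient_ring R\<^esub> fraction R c d = fraction R (r \<otimes> c) d"
proof -
  have "fraction R (r \<otimes> c') d' = fraction R (r \<otimes> c) d" if "(c', d') \<in> fraction R c d" for c' d'
  proof -
    have e: "c' \<in> carrier R" "d' \<in> regular_elements R" "c \<otimes> d' = c' \<otimes> d"
      using that assms by (simp_all add: mem_fraction_iff)
    note cl = e(1,2) assms e(2)[THEN regular_elements_closed] assms(3)[THEN regular_elements_closed]
    have "r \<otimes> c' \<otimes> d = r \<otimes> (c \<otimes> d')" using cl e(3) by (simp add: m_assoc)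
    then show ?thesis
      using cl by (simp add: fraction_eq_iff m_assoc)
  qed
  then show ?thesis
    unfolding total_quotient_ring_def module.simps
    by (intro UN_pair_const[OF fraction_self[OF assms(2,3)]])
qed

lemma zero_total_quotient_ring: "\<zero>\<^bsub>total_quotient_ring R\<^esub> = fraction R \<zero> \<one>"
  and one_total_quotient_ring: "\<one>\<^bsub>total_quotient_ring R\<^esub> = fraction R \<one> \<one>"
  by (simp_all add: total_quotient_ring_def)

lemma total_quotient_ring_cring: "cring (total_quotient_ring R)"
proof (intro cringI abelian_groupI comm_monoidI)
  fix x assume "x \<in> carrier (total_quotient_ring R)"
  then obtain a b where x: "x = fraction R a b" "a \<in> carrier R" "b \<in> regular_elements R"
    by (auto simp: carrier_total_quotient_ring)
  then have b: "b \<in> carrier R" by (simp add: regular_elements_closed)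
  show "\<exists>y \<in> carrier (total_quotient_ring R).
      y \<oplus>\<^bsub>total_quotient_ring R\<^esub> x = \<zero>\<^bsub>total_quotient_ring R\<^esub>"
  proof
    show "fraction R (\<ominus> a) b \<in> carrier (total_quotient_ring R)"
      using x by (simp add: fraction_closed)
    show "fraction R (\<ominus> a) b \<oplus>\<^bsub>total_quotient_ring R\<^esub> x = \<zero>\<^bsub>total_quotient_ring R\<^esub>"
      using x b
      by (simp add: fraction_add zero_total_quotient_ring fraction_eq_iff one_regular mult_regular
          l_minus l_neg)
  qed
  show "\<zero>\<^bsub>total_quotient_ring R\<^esub> \<oplus>\<^bsub>total_quotient_ring R\<^esub> x = x"
    "\<one>\<^bsub>total_quotient_ring R\<^esub> \<otimes>\<^bsub>total_quotient_ring R\<^esub> x = x"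
    using x b
    by (simp_all add: zero_total_quotient_ring one_total_quotient_ring fraction_add fraction_mult
        one_regular)
next
  fix x y z
  assume "x \<in> carrier (total_quotient_ring R)" "y \<in> carrier (total_quotient_ring R)"
    "z \<in> carrier (total_quotient_ring R)"
  then obtain a b c d e f where
    x: "x = fraction R a b" "a \<in> carrier R" "b \<in> regular_elements R" and
    y: "y = fraction R c d" "c \<in> carrier R" "d \<in> regular_elements R" and
    z: "z = fraction R e f" "e \<in> carrier R" "f \<in> regular_elements R"
    unfolding carrier_total_quotient_ring by blast
  have cl: "b \<in> carrier R" "d \<in> carrier R" "f \<in> carrier R"
    using x y z by (simp_all add: regular_elements_closed)
  have eq: "(a \<otimes> d \<oplus> c \<otimes> b) \<otimes> f \<oplus> e \<otimes> (b \<otimes> d) =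
      a \<otimes> (d \<otimes> f) \<oplus> (c \<otimes> f \<oplus> e \<otimes> d) \<otimes> b"
    using x(2) y(2) z(2) cl by algebra
  show "x \<oplus>\<^bsub>total_quotient_ring R\<^esub> y \<oplus>\<^bsub>total_quotient_ring R\<^esub> z =
      x \<oplus>\<^bsub>total_quotient_ring R\<^esub> (y \<oplus>\<^bsub>total_quotient_ring R\<^esub> z)"
    using x y z cl eq by (simp add: fraction_add mult_regular m_assoc)
  show "x \<otimes>\<^bsub>total_quotient_ring R\<^esub> y \<otimes>\<^bsub>total_quotient_ring R\<^esub> z =
      x \<otimes>\<^bsub>total_quotient_ring R\<^esub> (y \<otimes>\<^bsub>total_quotient_ring R\<^esub> z)"
    using x y z cl by (simp add: fraction_mult mult_regular m_assoc)
  have "(a \<otimes> d \<oplus> c \<otimes> b) \<otimes> e \<otimes> (b \<otimes> f \<otimes> (d \<otimes> f)) =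
      (a \<otimes> e \<otimes> (d \<otimes> f) \<oplus> c \<otimes> e \<otimes> (b \<otimes> f)) \<otimes> (b \<otimes> d \<otimes> f)"
    using x(2) y(2) z(2) cl by algebra
  then show "(x \<oplus>\<^bsub>total_quotient_ring R\<^esub> y) \<otimes>\<^bsub>total_quotient_ring R\<^esub> z =
      x \<otimes>\<^bsub>total_quotient_ring R\<^esub> z \<oplus>\<^bsub>total_quotient_ring R\<^esub> y \<otimes>\<^bsub>total_quotient_ring R\<^esub> z"
    using x y z cl by (simp add: fraction_add fraction_mult mult_regular fraction_eq_iff)
next
  fix x y
  assume "x \<in> carrier (total_quotient_ring R)" "y \<in> carrier (total_quotient_ring R)"
  then obtain a b c d where
    x: "x = fraction R a b" "a \<in> carrier R" "b \<in> regular_elements R" and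
    y: "y = fraction R c d" "c \<in> carrier R" "d \<in> regular_elements R"
    unfolding carrier_total_quotient_ring by blast
  have cl: "b \<in> carrier R" "d \<in> carrier R"
    using x y by (simp_all add: regular_elements_closed)
  show "x \<oplus>\<^bsub>total_quotient_ring R\<^esub> y \<in> carrier (total_quotient_ring R)"
    "x \<otimes>\<^bsub>total_quotient_ring R\<^esub> y \<in> carrier (total_quotient_ring R)"
    using x y cl by (simp_all add: fraction_add fraction_mult fraction_closed mult_regular)
  show "x \<oplus>\<^bsub>total_quotient_ring R\<^esub> y = y \<oplus>\<^bsub>total_quotient_ring R\<^esub> x"
    "x \<otimes>\<^bsub>total_quotient_ring R\<^esub> y = y \<otimes>\<^bsub>total_quotient_ring R\<^esub> x"
    using x y cl by (simp_all add: fraction_add fraction_mult m_comm a_comm)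
next
  show "\<zero>\<^bsub>total_quotient_ring R\<^esub> \<in> carrier (total_quotient_ring R)"
    "\<one>\<^bsub>total_quotient_ring R\<^esub> \<in> carrier (total_quotient_ring R)"
    by (simp_all add: zero_total_quotient_ring one_total_quotient_ring fraction_closed one_regular)
qed

lemma to_quotient_ring_hom: "to_quotient R \<in> ring_hom R (total_quotient_ring R)"
  by (rule ring_hom_memI)
    (simp_all add: to_quotient_def fraction_closed fraction_mult fraction_add one_regular
      one_total_quotient_ring)

lemma smult_total_quotient_ring:
  assumes "r \<in> carrier R" "x \<in> carrier (total_quotient_ring R)"
  shows "r \<odot>\<^bsub>total_quotient_ring R\<^esub> x = to_quotient R r \<otimes>\<^bsub>total_quotient_ring R\<^esub> x"
proof -
  obtain c d where "x = fraction R c d" "c \<in> carrier R" "d \<in> regular_elements R"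
    using assms(2) unfolding carrier_total_quotient_ring by blast
  then show ?thesis
    using assms(1)
    by (simp add: to_quotient_def fraction_smult fraction_mult one_regular regular_elements_closed)
qed

lemma fraction_mult_denominator:
  assumes "a \<in> carrier R" "b \<in> regular_elements R"
  shows "fraction R a b \<otimes>\<^bsub>total_quotient_ring R\<^esub> to_quotient R b = to_quotient R a"
  using assms
  by (simp add: to_quotient_def fraction_mult fraction_eq_iff one_regular mult_regular
      regular_elements_closed)

lemma to_quotient_inj: "inj_on (to_quotient R) (carrier R)"
  by (rule inj_onI) (simp add: to_quotient_def fraction_eq_iff one_regular)

end

section \<open>Invertible ideals, radical ideals and ISP-rings\<close>

text \<open>
  The library constant \<open>ideal_prod\<close> is the set of all sums of products, for arbitrary sets of
  ring elements; it is used here in \<open>T(R)\<close>, where \<open>R\<close> is identified with its image under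
  \<open>to_quotient R\<close>.
\<close>

definition invertible_ideal :: "'a set \<Rightarrow> ('a, 'm) ring_scheme \<Rightarrow> bool" where
  "invertible_ideal J R \<longleftrightarrow> ideal J R \<and>
    (\<exists>J'. submodule J' R (total_quotient_ring R) \<and>
      ideal_prod (total_quotient_ring R) (to_quotient R ` J) J' = to_quotient R ` carrier R)"

definition ideal_radical :: "('a, 'm) ring_scheme \<Rightarrow> 'a set \<Rightarrow> 'a set" where
  "ideal_radical R I = {x \<in> carrier R. \<exists>n::nat. n > 0 \<and> x [^]\<^bsub>R\<^esub> n \<in> I}"

definition radical_ideal :: "'a set \<Rightarrow> ('a, 'm) ring_scheme \<Rightarrow> bool" where
  "radical_ideal H R \<longleftrightarrow> ideal H R \<and> H \<noteq> carrier R \<and> ideal_radical R H = H"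

definition isp_ring :: "('a, 'm) ring_scheme \<Rightarrow> bool" where
  "isp_ring R \<longleftrightarrow>
    (\<forall>I. regular_ideal I R \<and> I \<noteq> carrier R \<longrightarrow>
      (\<exists>J Hs. invertible_ideal J R \<and> Hs \<noteq> [] \<and> (\<forall>H \<in> set Hs. radical_ideal H R) \<and>
        I = foldl (ideal_prod R) J Hs))"

section \<open>Manis valuations and N-rings\<close>

definition regular_localization ::
    "('a, 'm) ring_scheme \<Rightarrow> 'a set \<Rightarrow> ('a, ('a \<times> 'a) set) module" where
  "regular_localization R P =
    (total_quotient_ring R)
      \<lparr>carrier := {fraction R a b | a b. a \<in> carrier R \<and> b \<in> regular_elements R \<and> b \<notin> P}\<rparr>"

text \<open>
  The type \<open>'g extended\<close> also contains \<open>-\<infinity>\<close>; the condition on the image of the carrier says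
  that \<open>v\<close> maps onto \<open>G \<union> {\<infinity>}\<close>.
\<close>

definition manis_valuation ::
    "('b, 'm) ring_scheme \<Rightarrow> ('b \<Rightarrow> 'g::linordered_ab_group_add extended) \<Rightarrow> bool" where
  "manis_valuation T v \<longleftrightarrow>
    v ` carrier T = insert \<infinity> (range Fin) \<and>
    (\<forall>x \<in> carrier T. \<forall>y \<in> carrier T. v (x \<otimes>\<^bsub>T\<^esub> y) = v x + v y) \<and>
    (\<forall>x \<in> carrier T. \<forall>y \<in> carrier T. v (x \<oplus>\<^bsub>T\<^esub> y) \<ge> min (v x) (v y)) \<and>
    v \<one>\<^bsub>T\<^esub> = 0 \<and> v \<zero>\<^bsub>T\<^esub> = \<infinity>"

text \<open>
  A totally ordered abelian group that is isomorphic to the integers as a group is also isomorphic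
  to them as an ordered group, so the value group is taken to be \<open>int\<close> itself.
\<close>

definition discrete_rank_one_manis_valuation_ring :: "('a, 'm) ring_scheme \<Rightarrow> bool" where
  "discrete_rank_one_manis_valuation_ring R \<longleftrightarrow> nonzero_cring R \<and>
    (\<exists>v :: ('a \<times> 'a) set \<Rightarrow> int extended. manis_valuation (total_quotient_ring R) v \<and>
      to_quotient R ` carrier R = {x \<in> carrier (total_quotient_ring R). v x \<ge> 0})"

definition n_ring :: "('a, 'm) ring_scheme \<Rightarrow> bool" where
  "n_ring R \<longleftrightarrow>
    (\<forall>M. maximalideal M R \<and> regular_ideal M R \<longrightarrow>
      discrete_rank_one_manis_valuation_ring (regular_localization R M))"

end

theory Submission
  imports Defs "HOL-Algebra.Ring_Divisibility" "HOL-Algebra.Subrings"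
begin

text \<open>
  Let \<open>M\<close> be a regular maximal ideal, \<open>x \<in> M\<close> regular, and \<open>I = x A\<^bsub>(M)\<^esub> \<inter> A\<close>. Since all
  regular primes are maximal, \<open>M\<close> is the only prime ideal containing \<open>I\<close>, so every radical
  factor in \<open>I = J H\<^sub>1 \<cdots> H\<^sub>n\<close> equals \<open>M\<close>. Thus \<open>M\<close> is a factor of an ideal that is principal in
  \<open>A\<^bsub>(M)\<^esub>\<close>, and the Marot property makes \<open>M A\<^bsub>(M)\<^esub>\<close> itself principal, generated by a regular
  element \<open>t\<close>. Each regular element of \<open>A\<^bsub>(M)\<^esub>\<close> divides a power of \<open>t\<close> and is therefore a unit
  times a power of \<open>t\<close>, so the \<open>t\<close>-adic order extends to the required valuation.
\<close>

section \<open>The valuation of a regular prime element\<close>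

lemma (in cring) pow_regular:
  assumes "a \<in> regular_elements R"
  shows "a [^] (n::nat) \<in> regular_elements R"
  using assms by (induction n) (simp_all add: one_regular mult_regular)

lemma (in cring) mem_cgenideal_iff:
  assumes "a \<in> carrier R"
  shows "x \<in> PIdl a \<longleftrightarrow> (\<exists>y \<in> carrier R. x = a \<otimes> y)"
  using assms m_comm by (auto simp: cgenideal_def)

text \<open>The ideals generated by \<open>t [^] n\<close> decrease and begin with the whole ring,
  so the least \<open>n\<close> for which the power \<open>Suc n\<close> fails is the largest
  \<open>n\<close> for which \<open>t [^] n\<close> divides \<open>a\<close>. The intersection of
  these ideals need not be zero; all of its elements receive the value \<infinity>, which a Manis
  valuation permits.\<close>

definition adic_order :: "('a, 'm) ring_scheme \<Rightarrow> 'a \<Rightarrow> 'a \<Rightarrow> int extended" where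
  "adic_order R t a =
    (if \<forall>n::nat. a \<in> PIdl\<^bsub>R\<^esub> (t [^]\<^bsub>R\<^esub> n) then \<infinity>
     else Fin (int (LEAST n. a \<notin> PIdl\<^bsub>R\<^esub> (t [^]\<^bsub>R\<^esub> Suc n))))"

text \<open>The value is read off an arbitrary representative;
  \<open>quotient_order_fraction\<close> shows independence of the choice. Denominators will turn
  out to have finite order, so the subtraction never meets \<infinity> on the right.\<close>

definition quotient_order ::
    "('a, 'm) ring_scheme \<Rightarrow> 'a \<Rightarrow> ('a \<times> 'a) set \<Rightarrow> int extended" where
  "quotient_order R t X =
    (case SOME p. p \<in> X of (a, b) \<Rightarrow> adic_order R t a - adic_order R t b)"

text \<open>This isolates what is used of the regular localization, with \<open>t\<close> a
  generator of the extended maximal ideal. The last assumption forces every regular element to have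
  finite order.\<close>

locale adic_cring = cring +
  fixes t
  assumes t_regular: "t \<in> regular_elements R"
    and t_prime: "primeideal (PIdl t) R"
    and regular_divides_power: "b \<in> regular_elements R \<Longrightarrow> \<exists>n::nat. t [^] n \<in> PIdl b"
begin

lemma t_closed [simp]: "t \<in> carrier R"
  using t_regular by (rule regular_elements_closed)

lemma pow_cancel:
  assumes "t [^] (n::nat) \<otimes> x = t [^] n \<otimes> y" "x \<in> carrier R" "y \<in> carrier R"
  shows "x = y"
  using regular_cancel[OF pow_regular[OF t_regular]] assms by blast

text \<open>If \<open>m\<close> exceeded \<open>n\<close>, cancelling the regular element
  \<open>t [^] n\<close> would leave a factor \<open>t\<close> in \<open>c\<close>.\<close>

lemma pow_mult_mem_pow_iff:
  assumes "c \<in> carrier R" "c \<notin> PIdl t"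
  shows "t [^] (n::nat) \<otimes> c \<in> PIdl (t [^] (m::nat)) \<longleftrightarrow> m \<le> n"
proof
  assume "m \<le> n"
  then have "t [^] n \<otimes> c = t [^] m \<otimes> (t [^] (n - m) \<otimes> c)"
    using assms by (simp add: m_assoc[symmetric] nat_pow_mult)
  then show "t [^] n \<otimes> c \<in> PIdl (t [^] m)"
    using assms by (auto simp: mem_cgenideal_iff)
next
  assume "t [^] n \<otimes> c \<in> PIdl (t [^] m)"
  then obtain y where y: "y \<in> carrier R" "t [^] n \<otimes> c = t [^] m \<otimes> y"
    by (auto simp: mem_cgenideal_iff)
  show "m \<le> n"
  proof (rule ccontr)
    assume "\<not> m \<le> n"
    then obtain k where k: "m = n + Suc k"
      by (metis less_iff_Suc_add not_le add_Suc_right)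
    have "t [^] m = t [^] n \<otimes> (t \<otimes> t [^] k)"
      unfolding k by (subst nat_pow_mult[symmetric]) (simp_all add: m_comm)
    then have "t [^] n \<otimes> c = t [^] n \<otimes> (t \<otimes> (t [^] k \<otimes> y))"
      using y by (simp add: m_assoc)
    then have "c = t \<otimes> (t [^] k \<otimes> y)"
      using assms y by (intro pow_cancel[of n c "t \<otimes> (t [^] k \<otimes> y)"]) simp_all
    then show False
      using assms y by (auto simp: mem_cgenideal_iff)
  qed
qed

lemma adic_order_pow_mult:
  assumes "c \<in> carrier R" "c \<notin> PIdl t"
  shows "adic_order R t (t [^] (n::nat) \<otimes> c) = Fin (int n)"
proof -
  have "\<not> (\<forall>m::nat. t [^] n \<otimes> c \<in> PIdl (t [^] m))"
    using pow_mult_mem_pow_iff[OF assms] by (metis Suc_n_not_le_n)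
  moreover have "(LEAST k. t [^] n \<otimes> c \<notin> PIdl (t [^] Suc k)) = n"
    by (intro Least_equality)
      (simp_all only: pow_mult_mem_pow_iff[OF assms] Suc_n_not_le_n not_less_eq_eq not_not, simp_all)
  ultimately show ?thesis
    by (simp add: adic_order_def)
qed

lemma one_notin_cgenideal: "\<one> \<notin> PIdl t"
  using primeideal.I_notcarr[OF t_prime] ideal.one_imp_carrier[OF cgenideal_ideal[OF t_closed]]
  by blast

lemma adic_order_pow: "adic_order R t (t [^] (n::nat)) = Fin (int n)"
  using adic_order_pow_mult[of \<one> n] one_notin_cgenideal by simp

lemma adic_order_one: "adic_order R t \<one> = Fin 0"
  using adic_order_pow[of 0] by simp

lemma adic_order_zero: "adic_order R t \<zero> = \<infinity>"
  using additive_subgroup.zero_closed[OF ideal.axioms(1)[OF cgenideal_ideal]]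
  by (simp add: adic_order_def)

text \<open>An element outside some power is divided by the highest possible power of
  \<open>t\<close>; the cofactor then lies outside \<open>PIdl t\<close>. The later computations
  with orders rest on this normal form.\<close>

lemma adic_order_cases:
  assumes "a \<in> carrier R"
  obtains (infinite) "\<forall>n::nat. a \<in> PIdl (t [^] n)" "adic_order R t a = \<infinity>"
  | (finite) n c where "c \<in> carrier R" "c \<notin> PIdl t" "a = t [^] (n::nat) \<otimes> c"
      "adic_order R t a = Fin (int n)"
proof (cases "\<forall>n::nat. a \<in> PIdl (t [^] n)")
  case True
  then show ?thesis
    using infinite by (simp add: adic_order_def)
next
  case False
  \<comment> \<open>Here \<open>n\<close> is the first exponent that fails. It is positive because
    \<open>t [^] 0\<close> generates the whole ring, and its predecessor \<open>m\<close> is the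
    order of \<open>a\<close>.\<close>
  define n where "n = (LEAST n::nat. a \<notin> PIdl (t [^] n))"
  have n: "a \<notin> PIdl (t [^] n)"
    using False LeastI_ex[of "\<lambda>n::nat. a \<notin> PIdl (t [^] n)"] unfolding n_def by blast
  moreover have "a \<in> PIdl (t [^] (0::nat))"
    using assms by (simp add: mem_cgenideal_iff)
  ultimately obtain m where m: "n = Suc m"
    by (metis not0_implies_Suc)
  then have "a \<in> PIdl (t [^] m)"
    unfolding n_def by (metis lessI not_less_Least)
  then obtain c where c: "c \<in> carrier R" "a = t [^] m \<otimes> c"
    by (auto simp: mem_cgenideal_iff)
  have "c \<notin> PIdl t"
  proof
    assume "c \<in> PIdl t"
    then obtain d where "d \<in> carrier R" "c = t \<otimes> d"
      by (auto simp: mem_cgenideal_iff)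
    then have "a \<in> PIdl (t [^] n)"
      using c by (auto simp: m mem_cgenideal_iff m_assoc)
    then show False
      using n by simp
  qed
  then show ?thesis
    using finite c adic_order_pow_mult by blast
qed

lemma le_adic_order_iff:
  assumes "a \<in> carrier R"
  shows "Fin (int n) \<le> adic_order R t a \<longleftrightarrow> a \<in> PIdl (t [^] n)"
  using assms by (cases rule: adic_order_cases) (simp_all add: pow_mult_mem_pow_iff)

lemma adic_order_nonneg:
  assumes "a \<in> carrier R"
  shows "0 \<le> adic_order R t a"
  using le_adic_order_iff[OF assms, of 0] assms
  by (simp add: zero_extended_def mem_cgenideal_iff)

text \<open>In the normal forms the powers multiply, and primeness of \<open>PIdl t\<close> keeps
  the product of the two cofactors outside it. If one factor lies in all powers, so does the
  product.\<close>

lemma adic_order_mult: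
  assumes "a \<in> carrier R" "b \<in> carrier R"
  shows "adic_order R t (a \<otimes> b) = adic_order R t a + adic_order R t b"
proof -
  have infinite_mult: "adic_order R t (x \<otimes> y) = \<infinity>"
    if "x \<in> carrier R" "y \<in> carrier R" "\<forall>n::nat. x \<in> PIdl (t [^] n)" for x y
    using that ideal.I_r_closed[OF cgenideal_ideal] by (simp add: adic_order_def)
  show ?thesis
    using assms(1)
  proof (cases rule: adic_order_cases)
    case infinite
    then show ?thesis
      using assms infinite_mult[of a b] by (cases rule: adic_order_cases[OF assms(2)]) auto
  next
    case (finite n c)
    note a = this
    show ?thesis
      using assms(2)
    proof (cases rule: adic_order_cases)
      case infinite
      then show ?thesis
        using assms a infinite_mult[of b a] by (simp add: m_comm)
    next
      case (finite m d)
      have "c \<otimes> d \<notin> PIdl t"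
        using a finite primeideal.I_prime[OF t_prime] by blast
      moreover have "a \<otimes> b = t [^] (n + m) \<otimes> (c \<otimes> d)"
        using a(1,3) finite(1,3) by (simp add: nat_pow_mult[symmetric] m_ac)
      ultimately show ?thesis
        using a finite adic_order_pow_mult[of "c \<otimes> d" "n + m"] by simp
    qed
  qed
qed

text \<open>If the sum has finite order \<open>n\<close>, it lies outside the ideal of
  \<open>t [^] Suc n\<close>, so one summand does too and has order at most
  \<open>n\<close>.\<close>

lemma adic_order_add:
  assumes "a \<in> carrier R" "b \<in> carrier R"
  shows "min (adic_order R t a) (adic_order R t b) \<le> adic_order R t (a \<oplus> b)"
  using a_closed[OF assms]
proof (cases rule: adic_order_cases)
  case (finite n c)
  have "a \<oplus> b \<notin> PIdl (t [^] Suc n)"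
    unfolding finite(3) pow_mult_mem_pow_iff[OF finite(1,2)] by simp
  then have "a \<notin> PIdl (t [^] Suc n) \<or> b \<notin> PIdl (t [^] Suc n)"
    using additive_subgroup.a_closed[OF ideal.axioms(1)[OF cgenideal_ideal[OF nat_pow_closed]]]
      t_closed by blast
  then have "\<not> Fin (int (Suc n)) \<le> adic_order R t a \<or> \<not> Fin (int (Suc n)) \<le> adic_order R t b"
    using assms by (simp only: le_adic_order_iff not_False_eq_True)
  then show ?thesis
    using finite(4) by (cases "adic_order R t a"; cases "adic_order R t b") auto
qed simp

text \<open>If \<open>c\<close> divides \<open>t [^] m\<close> but is outside the prime ideal generated by \<open>t\<close>, then the
  cofactor is divisible by \<open>t [^] m\<close>, and cancellation makes \<open>c\<close> a unit.\<close>

lemma regular_eq_pow_mult_unit: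
  assumes "b \<in> regular_elements R"
  obtains n u where "u \<in> Units R" "u \<notin> PIdl t" "b = t [^] (n::nat) \<otimes> u"
    "adic_order R t b = Fin (int n)"
proof -
  have b: "b \<in> carrier R"
    using assms by (rule regular_elements_closed)
  obtain m :: nat and e where e: "e \<in> carrier R" "t [^] m = b \<otimes> e"
    using regular_divides_power[OF assms] b by (auto simp: mem_cgenideal_iff)
  show ?thesis
    using b
  proof (cases rule: adic_order_cases)
    \<comment> \<open>This case cannot occur: \<open>b\<close> divides \<open>t [^] m\<close>, which
      has finite order, while orders add and are nonnegative.\<close>
    case infinite
    then show ?thesis
      using adic_order_pow[of m] e adic_order_mult[OF b e(1)] adic_order_nonneg[OF e(1)]
      by (cases "adic_order R t e") auto
  next
    case (finite n c)
    have "Fin (int m) = Fin (int n) + adic_order R t e"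
      using adic_order_pow[of m] e adic_order_mult[OF b e(1)] finite(4) by simp
    then have "n \<le> m" "Fin (int (m - n)) \<le> adic_order R t e"
      using adic_order_nonneg[OF e(1)]
      by (cases "adic_order R t e"; auto simp: zero_extended_def)+
    then obtain f where f: "f \<in> carrier R" "e = t [^] (m - n) \<otimes> f"
      using e(1) unfolding le_adic_order_iff[OF e(1)] by (auto simp: mem_cgenideal_iff)
    have "t [^] m \<otimes> \<one> = t [^] m \<otimes> (c \<otimes> f)"
    proof -
      have "t [^] m \<otimes> \<one> = b \<otimes> e"
        using b e by simp
      also have "\<dots> = t [^] n \<otimes> c \<otimes> (t [^] (m - n) \<otimes> f)"
        by (simp only: finite(3) f(2))
      also have "\<dots> = (t [^] n \<otimes> t [^] (m - n)) \<otimes> (c \<otimes> f)"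
        using finite(1) f(1) by (simp add: m_ac)
      finally show ?thesis
        using \<open>n \<le> m\<close> by (simp add: nat_pow_mult)
    qed
    then have "c \<otimes> f = \<one>"
      using pow_cancel[of m \<one> "c \<otimes> f"] finite(1) f(1) by simp
    then have "c \<in> Units R"
      using finite(1) f(1) m_comm[of c f] by (auto simp: Units_def)
    then show ?thesis
      using finite that by blast
  qed
qed

section \<open>Extension of the order to the total quotient ring\<close>

lemma quotient_order_fraction:
  assumes "a \<in> carrier R" "b \<in> regular_elements R"
  shows "quotient_order R t (fraction R a b) = adic_order R t a - adic_order R t b"
proof -
  have "adic_order R t c - adic_order R t d = adic_order R t a - adic_order R t b"
    if "(c, d) \<in> fraction R a b" for c d
  proof -
    have cd: "c \<in> carrier R" "d \<in> regular_elements R" "a \<otimes> d = c \<otimes> b"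
      using that assms by (simp_all add: mem_fraction_iff)
    \<comment> \<open>Cross-multiplication becomes an equality of sums of orders; the orders of
      \<open>b\<close> and \<open>d\<close> are finite and can be moved across.\<close>
    have "adic_order R t a + adic_order R t d = adic_order R t c + adic_order R t b"
      using cd(3) assms cd(1,2)
      by (simp add: adic_order_mult[symmetric] regular_elements_closed)
    moreover obtain m where "adic_order R t b = Fin m"
      using assms(2) by (rule regular_eq_pow_mult_unit)
    moreover obtain n where "adic_order R t d = Fin n"
      using cd(2) by (rule regular_eq_pow_mult_unit)
    ultimately show ?thesis
      using adic_order_nonneg[OF assms(1)] adic_order_nonneg[OF cd(1)]
      by (cases "adic_order R t a"; cases "adic_order R t c") (auto simp: zero_extended_def)
  qed
  moreover have "(SOME p. p \<in> fraction R a b) \<in> fraction R a b"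
    using fraction_self[OF assms] by (rule someI)
  ultimately show ?thesis
    unfolding quotient_order_def by (cases "SOME p. p \<in> fraction R a b") simp
qed

lemma total_quotient_order_cases:
  assumes "x \<in> carrier (total_quotient_ring R)"
  obtains a b n where "x = fraction R a b" "a \<in> carrier R" "b \<in> regular_elements R"
    "adic_order R t b = Fin n" "quotient_order R t x = adic_order R t a - Fin n"
proof -
  obtain a b where x: "x = fraction R a b" "a \<in> carrier R" "b \<in> regular_elements R"
    using assms unfolding carrier_total_quotient_ring by blast
  moreover obtain n where "adic_order R t b = Fin n"
    using x(3) by (rule regular_eq_pow_mult_unit)
  ultimately show ?thesis
    using that quotient_order_fraction by simp
qed

lemma manis_valuation_quotient_order:
  "manis_valuation (total_quotient_ring R) (quotient_order R t)"
  unfolding manis_valuation_def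
proof (intro conjI ballI)
  let ?T = "total_quotient_ring R" and ?v = "quotient_order R t"
  show "?v \<one>\<^bsub>?T\<^esub> = 0" and "?v \<zero>\<^bsub>?T\<^esub> = \<infinity>"
    by (simp_all add: one_total_quotient_ring zero_total_quotient_ring quotient_order_fraction
        one_regular adic_order_one adic_order_zero zero_extended_def)
  fix x y assume x: "x \<in> carrier ?T" and y: "y \<in> carrier ?T"
  obtain a b n where a: "x = fraction R a b" "a \<in> carrier R" "b \<in> regular_elements R"
    "adic_order R t b = Fin n" "?v x = adic_order R t a - Fin n"
    using x by (rule total_quotient_order_cases)
  obtain c d m where c: "y = fraction R c d" "c \<in> carrier R" "d \<in> regular_elements R"
    "adic_order R t d = Fin m" "?v y = adic_order R t c - Fin m"
    using y by (rule total_quotient_order_cases)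
  note cl = regular_elements_closed[OF a(3)] regular_elements_closed[OF c(3)]
  show "?v (x \<otimes>\<^bsub>?T\<^esub> y) = ?v x + ?v y"
    using a c cl adic_order_nonneg[OF a(2)] adic_order_nonneg[OF c(2)]
    by (cases "adic_order R t a"; cases "adic_order R t c")
      (auto simp: fraction_mult quotient_order_fraction mult_regular adic_order_mult
        zero_extended_def)
  \<comment> \<open>Over the common denominator \<open>b \<otimes> d\<close> the inequality reduces
    to \<open>adic_order_add\<close> for the two new numerators.\<close>
  show "min (?v x) (?v y) \<le> ?v (x \<oplus>\<^bsub>?T\<^esub> y)"
    using a c cl adic_order_nonneg[OF a(2)] adic_order_nonneg[OF c(2)]
      adic_order_nonneg[of "a \<otimes> d \<oplus> c \<otimes> b"] adic_order_add[of "a \<otimes> d" "c \<otimes> b"]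
    by (cases "adic_order R t a"; cases "adic_order R t c";
        cases "adic_order R t (a \<otimes> d \<oplus> c \<otimes> b)")
      (auto simp: fraction_add quotient_order_fraction mult_regular adic_order_mult
        zero_extended_def)
next
  let ?T = "total_quotient_ring R" and ?v = "quotient_order R t"
  show "?v ` carrier ?T = insert \<infinity> (range Fin)"
  proof
    show "?v ` carrier ?T \<subseteq> insert \<infinity> (range Fin)"
    proof (rule image_subsetI)
      fix x assume "x \<in> carrier ?T"
      then obtain a b n where a: "a \<in> carrier R" "?v x = adic_order R t a - Fin n"
        by (rule total_quotient_order_cases)
      then show "?v x \<in> insert \<infinity> (range Fin)"
        using adic_order_nonneg[OF a(1)]
        by (cases "adic_order R t a") (auto simp: zero_extended_def)
    qed
    have "\<infinity> = ?v (fraction R \<zero> \<one>)"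
      by (simp add: quotient_order_fraction one_regular adic_order_one
          adic_order_zero)
    \<comment> \<open>Since \<open>nat\<close> truncates at zero, at least one of the two powers is
      \<one>, and the difference of the exponents is \<open>k\<close> for either sign.\<close>
    moreover have "Fin k = ?v (fraction R (t [^] nat k) (t [^] nat (- k)))" for k
      by (simp add: quotient_order_fraction pow_regular t_regular adic_order_pow)
    ultimately show "insert \<infinity> (range Fin) \<subseteq> ?v ` carrier ?T"
      using t_regular by (auto intro!: image_eqI fraction_closed one_regular pow_regular)
  qed
qed

text \<open>For a fraction of nonnegative value, write the denominator as \<open>t [^] m\<close>
  times a unit. The numerator has order at least \<open>m\<close>, so the power cancels and only the
  unit remains below.\<close>

lemma image_to_quotient_eq:
  "to_quotient R ` carrier R =
    {x \<in> carrier (total_quotient_ring R). 0 \<le> quotient_order R t x}"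
proof (intro equalityI subsetI)
  fix x assume "x \<in> to_quotient R ` carrier R"
  then obtain a where a: "a \<in> carrier R" "x = fraction R a \<one>"
    by (auto simp: to_quotient_def)
  show "x \<in> {x \<in> carrier (total_quotient_ring R). 0 \<le> quotient_order R t x}"
    using a adic_order_nonneg[OF a(1)]
    by (cases "adic_order R t a")
      (auto simp: fraction_closed one_regular quotient_order_fraction adic_order_one
        zero_extended_def)
next
  fix x assume x: "x \<in> {x \<in> carrier (total_quotient_ring R). 0 \<le> quotient_order R t x}"
  then obtain a b n where a: "x = fraction R a b" "a \<in> carrier R" "b \<in> regular_elements R"
    "adic_order R t b = Fin n" "quotient_order R t x = adic_order R t a - Fin n"
    using total_quotient_order_cases by blast
  obtain m u where u: "u \<in> Units R" "b = t [^] m \<otimes> u" "adic_order R t b = Fin (int m)"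
    using a(3) by (rule regular_eq_pow_mult_unit)
  have "Fin (int m) \<le> adic_order R t a"
    using x a(4,5) u(3) by (cases "adic_order R t a") (auto simp: zero_extended_def)
  then obtain e where e: "e \<in> carrier R" "a = t [^] m \<otimes> e"
    using a(2) by (auto simp: le_adic_order_iff mem_cgenideal_iff)
  have "a = inv u \<otimes> e \<otimes> b"
  proof -
    have "inv u \<otimes> e \<otimes> b = t [^] m \<otimes> e \<otimes> (inv u \<otimes> u)"
      using u(1) Units_closed[OF u(1)] e(1) by (simp add: u(2) m_ac del: Units_l_inv Units_r_inv)
    then show ?thesis
      using u(1) e by simp
  qed
  then have "x = to_quotient R (inv u \<otimes> e)"
    using a u(1) e(1) by (simp add: to_quotient_def fraction_eq_iff one_regular)
  then show "x \<in> to_quotient R ` carrier R"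
    using u(1) e(1) by simp
qed

lemma discrete_rank_one: "discrete_rank_one_manis_valuation_ring R"
proof -
  have "\<one> \<noteq> \<zero>"
    using one_notin_cgenideal
      additive_subgroup.zero_closed[OF ideal.axioms(1)[OF cgenideal_ideal[OF t_closed]]]
    by metis
  then show ?thesis
    unfolding discrete_rank_one_manis_valuation_ring_def nonzero_cring_def
    using is_cring manis_valuation_quotient_order image_to_quotient_eq by blast
qed

end

section \<open>Contractions of extended ideals\<close>

context cring
begin

lemma idealI_mult_closed:
  assumes "I \<subseteq> carrier R" "\<zero> \<in> I" "\<And>a b. a \<in> I \<Longrightarrow> b \<in> I \<Longrightarrow> a \<oplus> b \<in> I"
    "\<And>a x. a \<in> I \<Longrightarrow> x \<in> carrier R \<Longrightarrow> x \<otimes> a \<in> I"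
  shows "ideal I R"
proof (rule idealI[OF ring_axioms])
  have "\<ominus> a \<in> I" if "a \<in> I" for a
  proof -
    have "\<ominus> a = \<ominus> \<one> \<otimes> a"
      using that assms(1) by (simp add: subset_iff l_minus)
    then show ?thesis
      using that assms(4) by simp
  qed
  then show "subgroup I (add_monoid R)"
    using assms(1-3) by (intro add.subgroupI) (auto simp: a_inv_def)
  show "x \<otimes> a \<in> I" "a \<otimes> x \<in> I" if "a \<in> I" "x \<in> carrier R" for a x
    using that assms(1,4) m_comm[of a x] by auto
qed

lemma ideal_subset_carrier: "ideal I R \<Longrightarrow> I \<subseteq> carrier R"
  by (rule additive_subgroup.a_subset[OF ideal.axioms(1)])

text \<open>Zorn's lemma gives an ideal maximal among those that contain \<open>I\<close> and miss
  the multiplicative set \<open>S\<close>; such an ideal is prime.\<close>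

lemma prime_ideal_avoiding:
  assumes "ideal I R" "S \<subseteq> carrier R" "\<one> \<in> S" "\<And>x y. x \<in> S \<Longrightarrow> y \<in> S \<Longrightarrow> x \<otimes> y \<in> S"
    "I \<inter> S = {}"
  obtains P where "primeideal P R" "I \<subseteq> P" "P \<inter> S = {}"
proof -
  define F where "F = {J. ideal J R \<and> I \<subseteq> J \<and> J \<inter> S = {}}"
  have "\<exists>M \<in> F. \<forall>J \<in> F. M \<subseteq> J \<longrightarrow> J = M"
  proof (rule subset_Zorn_nonempty)
    show "F \<noteq> {}"
      using assms(1,5) unfolding F_def by blast
    fix C assume C: "C \<noteq> {}" "subset.chain F C"
    then have "ideal (\<Union>C) R"
      using chain_Union_is_ideal[of C] by (auto simp: F_def pred_on.chain_def)
    then show "\<Union>C \<in> F"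
      using C by (fastforce simp: F_def pred_on.chain_def)
  qed
  then obtain M where "M \<in> F" and max_F: "\<And>J. J \<in> F \<Longrightarrow> M \<subseteq> J \<Longrightarrow> J = M"
    by blast
  then have M: "ideal M R" "I \<subseteq> M" "M \<inter> S = {}"
    by (simp_all add: F_def)
  have max: "J = M" if "ideal J R" "M \<subseteq> J" "J \<inter> S = {}" for J
    using that M(2) max_F by (auto simp: F_def)
  interpret M: ideal M R by fact
  \<comment> \<open>Adjoining \<open>a\<close> gives a strictly larger ideal, which by maximality of
    \<open>M\<close> can no longer miss \<open>S\<close>.\<close>
  have meets: "\<exists>m \<in> M. \<exists>x \<in> carrier R. m \<oplus> x \<otimes> a \<in> S" if a: "a \<in> carrier R" "a \<notin> M" for a
  proof -
    have J: "ideal (M <+>\<^bsub>R\<^esub> PIdl a) R"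
      using M(1) cgenideal_ideal[OF a(1)] by (rule add_ideals)
    have "m \<in> M <+>\<^bsub>R\<^esub> PIdl a" if "m \<in> M" for m
    proof -
      have "m \<oplus> \<zero> \<otimes> a \<in> M <+>\<^bsub>R\<^esub> PIdl a"
        using that by (auto simp: set_add_def' cgenideal_def)
      then show ?thesis
        using that a by simp
    qed
    moreover have "a \<in> M <+>\<^bsub>R\<^esub> PIdl a"
    proof -
      have "\<zero> \<oplus> \<one> \<otimes> a \<in> M <+>\<^bsub>R\<^esub> PIdl a"
        using M.zero_closed by (fastforce simp: set_add_def' cgenideal_def)
      then show ?thesis
        using a by simp
    qed
    ultimately have "(M <+>\<^bsub>R\<^esub> PIdl a) \<inter> S \<noteq> {}"
      using max[OF J] a(2) by blast
    then show ?thesis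
      by (auto simp: set_add_def' cgenideal_def)
  qed
  have "primeideal M R"
  proof (rule primeidealI[OF M(1) is_cring])
    show "carrier R \<noteq> M"
      using M(3) assms(3) by auto
    fix a b assume ab: "a \<in> carrier R" "b \<in> carrier R" "a \<otimes> b \<in> M"
    show "a \<in> M \<or> b \<in> M"
    proof (rule ccontr)
      assume neg: "\<not> (a \<in> M \<or> b \<in> M)"
      obtain m x where mx: "m \<in> M" "x \<in> carrier R" "m \<oplus> x \<otimes> a \<in> S"
        using meets[of a] ab(1) neg by auto
      obtain n y where ny: "n \<in> M" "y \<in> carrier R" "n \<oplus> y \<otimes> b \<in> S"
        using meets[of b] ab(2) neg by auto
      note cl = ab(1,2) mx(2) ny(2) M.Icarr[OF mx(1)] M.Icarr[OF ny(1)]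
      \<comment> \<open>The product of the two elements of \<open>S\<close> expands into terms that
        each contain \<open>m\<close>, \<open>n\<close> or \<open>a \<otimes> b\<close>, so it would
        lie in both \<open>M\<close> and \<open>S\<close>.\<close>
      have "(m \<oplus> x \<otimes> a) \<otimes> (n \<oplus> y \<otimes> b) =
          m \<otimes> (n \<oplus> y \<otimes> b) \<oplus> (x \<otimes> a \<otimes> n \<oplus> x \<otimes> y \<otimes> (a \<otimes> b))"
        using cl by algebra
      also have "\<dots> \<in> M"
        using cl ab(3) mx(1) ny(1) by (simp add: M.a_closed M.I_l_closed M.I_r_closed)
      finally show False
        using assms(4)[OF mx(3) ny(3)] M(3) by blast
    qed
  qed
  then show ?thesis
    using that M(2,3) by blast
qed

text \<open>The regular generators of \<open>I\<close> already lie in \<open>J\<close>. The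
  contrapositive is the main use: if \<open>I\<close> is not inside \<open>J\<close>, some regular
  element of \<open>I\<close> lies outside \<open>J\<close>.\<close>

lemma marot_subsetI:
  assumes "marot_ring R" "regular_ideal I R" "ideal J R" "I \<inter> regular_elements R \<subseteq> J"
  shows "I \<subseteq> J"
proof -
  obtain S where S: "S \<subseteq> regular_elements R" "I = Idl S"
    using assms(1,2) unfolding marot_ring_def by blast
  then have "S \<subseteq> I"
    using genideal_self[of S] regular_elements_closed[of _ R] by auto
  then have "S \<subseteq> J"
    using S(1) assms(4) by blast
  then show ?thesis
    unfolding S(2) by (rule genideal_minimal[OF assms(3)])
qed

lemma regular_ideal_mono:
  assumes "regular_ideal I R" "I \<subseteq> J" "ideal J R"
  shows "regular_ideal J R"
  using assms unfolding regular_ideal_def by blast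

end

text \<open>The contraction to \<open>R\<close> of the extension of \<open>I\<close> to \<open>R\<^bsub>(M)\<^esub>\<close>.\<close>

definition regular_saturation :: "('a, 'm) ring_scheme \<Rightarrow> 'a set \<Rightarrow> 'a set \<Rightarrow> 'a set" where
  "regular_saturation R M I =
    {a \<in> carrier R. \<exists>s \<in> regular_elements R. s \<notin> M \<and> s \<otimes>\<^bsub>R\<^esub> a \<in> I}"

section \<open>Saturated ideals at a maximal ideal of a Marot ring\<close>

locale regular_maximal = cring +
  fixes M
  assumes maximal: "maximalideal M R"
    and marot: "marot_ring R"
begin

lemma prime: "primeideal M R"
  using maximal by (rule maximalideal_prime)

lemma mult_notin:
  assumes "a \<in> carrier R" "b \<in> carrier R" "a \<notin> M" "b \<notin> M"
  shows "a \<otimes> b \<notin> M"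
  using assms primeideal.I_prime[OF prime] by blast

lemma one_notin: "\<one> \<notin> M"
  using maximalideal.I_notcarr[OF maximal]
    ideal.one_imp_carrier[OF maximalideal.axioms(1)[OF maximal]] by blast

text \<open>Two multipliers \<open>s\<close> and \<open>r\<close> combine to
  \<open>s \<otimes> r\<close>, which is again regular and, \<open>M\<close> being prime, again
  outside \<open>M\<close>.\<close>

lemma regular_saturation_ideal:
  assumes "ideal I R"
  shows "ideal (regular_saturation R M I) R"
proof (rule idealI_mult_closed)
  interpret I: ideal I R by fact
  show "regular_saturation R M I \<subseteq> carrier R"
    by (auto simp: regular_saturation_def)
  show "\<zero> \<in> regular_saturation R M I"
    using one_notin one_regular I.zero_closed by (auto simp: regular_saturation_def)
  fix a assume "a \<in> regular_saturation R M I"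
  then obtain s where a: "a \<in> carrier R" "s \<in> regular_elements R" "s \<notin> M" "s \<otimes> a \<in> I"
    by (auto simp: regular_saturation_def)
  note s = regular_elements_closed[OF a(2)]
  show "x \<otimes> a \<in> regular_saturation R M I" if x: "x \<in> carrier R" for x
  proof -
    have "s \<otimes> (x \<otimes> a) = x \<otimes> (s \<otimes> a)"
      using a(1) s x by (simp add: m_ac)
    then show ?thesis
      using a x I.I_l_closed by (auto simp: regular_saturation_def)
  qed
  fix b assume "b \<in> regular_saturation R M I"
  then obtain r where b: "b \<in> carrier R" "r \<in> regular_elements R" "r \<notin> M" "r \<otimes> b \<in> I"
    by (auto simp: regular_saturation_def)
  note r = regular_elements_closed[OF b(2)]
  have "s \<otimes> r \<otimes> (a \<oplus> b) = r \<otimes> (s \<otimes> a) \<oplus> s \<otimes> (r \<otimes> b)"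
    using a(1) b(1) s r by algebra
  also have "\<dots> \<in> I"
    using a(4) b(4) s r by (simp add: I.I_l_closed I.a_closed)
  finally show "a \<oplus> b \<in> regular_saturation R M I"
    using a b s r mult_notin[of s r] mult_regular[of s r] by (auto simp: regular_saturation_def)
qed

lemma subset_regular_saturation:
  assumes "ideal I R"
  shows "I \<subseteq> regular_saturation R M I"
  using one_notin one_regular ideal.Icarr[OF assms] by (auto simp: regular_saturation_def)

lemma regular_saturation_subset:
  assumes "I \<subseteq> M"
  shows "regular_saturation R M I \<subseteq> M"
proof
  fix a assume "a \<in> regular_saturation R M I"
  then obtain s where s: "a \<in> carrier R" "s \<in> regular_elements R" "s \<notin> M" "s \<otimes> a \<in> I"
    by (auto simp: regular_saturation_def)
  then have "s \<otimes> a \<in> M"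
    using assms by auto
  then show "a \<in> M"
    using s(1-3) mult_notin[of s a] by (auto simp: regular_elements_closed)
qed

lemma regular_saturation_cancel:
  assumes "s \<in> regular_elements R" "s \<notin> M" "a \<in> carrier R"
    "s \<otimes> a \<in> regular_saturation R M I"
  shows "a \<in> regular_saturation R M I"
proof -
  obtain r where r: "r \<in> regular_elements R" "r \<notin> M" "r \<otimes> (s \<otimes> a) \<in> I"
    using assms(4) by (auto simp: regular_saturation_def)
  have "r \<otimes> s \<otimes> a \<in> I"
    using r(3) assms(1,3) r(1) by (simp add: m_assoc regular_elements_closed)
  then show ?thesis
    using assms(1-3) r(1,2) mult_notin[of r s] mult_regular[of r s]
    by (auto simp: regular_saturation_def regular_elements_closed)
qed

text \<open>If \<open>P \<noteq> M\<close>, then the Marot property yields a regular \<open>s\<close> in \<open>P - M\<close>. Since \<open>s\<close> is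
  not a zero-divisor modulo the saturation, a prime ideal over the saturation inside \<open>P\<close> can be
  chosen to avoid \<open>s\<close>, which contradicts the maximality of all regular primes.\<close>

lemma prime_over_regular_saturation:
  assumes "\<And>P. primeideal P R \<Longrightarrow> regular_ideal P R \<Longrightarrow> maximalideal P R"
    and "regular_ideal I R" "primeideal P R" "regular_saturation R M I \<subseteq> P"
  shows "P = M"
proof (rule ccontr)
  assume "P \<noteq> M"
  let ?I = "regular_saturation R M I"
  have I: "ideal I R" "ideal ?I R" "I \<subseteq> ?I"
    using assms(2) regular_saturation_ideal subset_regular_saturation
    by (simp_all add: regular_ideal_def)
  have P: "ideal P R" "regular_ideal P R"
    using assms(2-4) I(3) regular_ideal_mono primeideal.axioms(1) by blast+
  \<comment> \<open>\<open>P\<close> contains the regular ideal \<open>I\<close>, so it is maximal,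
    and distinct maximal ideals are incomparable.\<close>
  have "\<not> P \<subseteq> M"
    using maximalideal.I_maximal[OF assms(1)[OF assms(3) P(2)]] \<open>P \<noteq> M\<close>
      maximalideal.axioms(1)[OF maximal] maximalideal.I_notcarr[OF maximal] ideal_subset_carrier
    by blast
  then obtain s where s: "s \<in> P" "s \<in> regular_elements R" "s \<notin> M"
    using marot_subsetI[OF marot P(2) maximalideal.axioms(1)[OF maximal]] by blast
  have scl: "s \<in> carrier R"
    using s(2) by (rule regular_elements_closed)
  \<comment> \<open>The terms with \<open>n = 0\<close> make a prime that misses \<open>S\<close>
    lie inside \<open>P\<close>; the term with \<open>n = 1\<close> and \<open>u = \<one>\<close>
    keeps \<open>s\<close> out of it.\<close>
  define S where "S = {s [^] (n::nat) \<otimes> u | n u. u \<in> carrier R - P}"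
  have "\<one> \<notin> P"
    using primeideal.I_notcarr[OF assms(3)] ideal.one_imp_carrier[OF P(1)] by blast
  have S: "s [^] n \<otimes> u \<in> S" if "u \<in> carrier R" "u \<notin> P" for n :: nat and u
    using that unfolding S_def by blast
  have "S \<subseteq> carrier R"
    using scl by (auto simp: S_def)
  moreover have "\<one> \<in> S"
    using S[of \<one> 0] \<open>\<one> \<notin> P\<close> by simp
  moreover have "x \<otimes> y \<in> S" if xy: "x \<in> S" "y \<in> S" for x y
  proof -
    obtain n u m v where u: "x = s [^] (n::nat) \<otimes> u" "u \<in> carrier R" "u \<notin> P"
      and v: "y = s [^] (m::nat) \<otimes> v" "v \<in> carrier R" "v \<notin> P"
      using xy unfolding S_def by blast
    have "x \<otimes> y = s [^] (n + m) \<otimes> (u \<otimes> v)"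
      using u(1,2) v(1,2) scl by (simp add: nat_pow_mult[symmetric] m_ac)
    moreover have "u \<otimes> v \<notin> P"
      using u v primeideal.I_prime[OF assms(3)] by blast
    ultimately show ?thesis
      using S u(2) v(2) by simp
  qed
  \<comment> \<open>The factors \<open>s\<close> are cancelled one at a time modulo the saturation,
    which leaves \<open>u\<close> in the saturation and hence in \<open>P\<close>.\<close>
  moreover have "?I \<inter> S = {}"
  proof -
    have "u \<in> ?I" if "s [^] (n::nat) \<otimes> u \<in> ?I" "u \<in> carrier R" for n u
      using that
    proof (induction n)
      case (Suc n)
      then have "s \<otimes> (s [^] n \<otimes> u) \<in> ?I"
        using scl by (simp add: m_ac)
      then show ?case
        using regular_saturation_cancel[OF s(2,3), of "s [^] n \<otimes> u" I] Suc scl by simp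
    qed simp
    then show ?thesis
      using assms(4) by (auto simp: S_def)
  qed
  ultimately obtain Q where Q: "primeideal Q R" "?I \<subseteq> Q" "Q \<inter> S = {}"
    using prime_ideal_avoiding[OF I(2)] by blast
  have "ideal Q R"
    using Q(1) by (rule primeideal.axioms(1))
  then have "maximalideal Q R"
    using assms(1,2) Q(1,2) I(3) regular_ideal_mono by blast
  moreover have "Q \<subseteq> P"
  proof
    fix q assume q: "q \<in> Q"
    then have "q \<in> carrier R" "q \<notin> S"
      using ideal.Icarr[OF \<open>ideal Q R\<close>] Q(3) by auto
    then show "q \<in> P"
      using S[of q 0] by auto
  qed
  ultimately have "Q = P"
    using maximalideal.I_maximal[of Q R P] P(1) ideal_subset_carrier[OF P(1)]
      primeideal.I_notcarr[OF assms(3)] by auto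
  moreover have "s \<notin> Q"
    using S[of \<one> 1] \<open>\<one> \<notin> P\<close> Q(3) scl by auto
  ultimately show False
    using s(1) by blast
qed

text \<open>Otherwise some prime over the saturation would miss all powers of \<open>a\<close>; but
  the only such prime is \<open>M\<close>, which contains \<open>a\<close>. The exponent 0 covers
  the case in which the saturation is the whole ring.\<close>

lemma power_in_regular_saturation:
  assumes "\<And>P. primeideal P R \<Longrightarrow> regular_ideal P R \<Longrightarrow> maximalideal P R"
    and "regular_ideal I R" "a \<in> M"
  shows "\<exists>n::nat. a [^] n \<in> regular_saturation R M I"
proof (rule ccontr)
  let ?I = "regular_saturation R M I" and ?S = "range (\<lambda>n::nat. a [^] n)"
  assume "\<not> ?thesis"
  then have disj: "?I \<inter> ?S = {}"
    by blast
  have a: "a \<in> carrier R"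
    using assms(3) ideal_subset_carrier[OF maximalideal.axioms(1)[OF maximal]] by blast
  then have "?S \<subseteq> carrier R"
    by auto
  moreover have "\<one> \<in> ?S"
    by (rule range_eqI[of _ _ 0]) simp
  moreover have "x \<otimes> y \<in> ?S" if "x \<in> ?S" "y \<in> ?S" for x y
    using that a by (auto simp: nat_pow_mult)
  ultimately obtain Q where Q: "primeideal Q R" "?I \<subseteq> Q" "Q \<inter> ?S = {}"
    using prime_ideal_avoiding[of ?I ?S] assms(2) disj regular_saturation_ideal
    unfolding regular_ideal_def by blast
  then have "Q = M"
    using prime_over_regular_saturation assms(1,2) by blast
  moreover have "a \<in> ?S"
    using a by (intro range_eqI[of _ _ 1]) simp
  ultimately show False
    using Q(3) assms(3) by blast
qed

text \<open>Every element of \<open>M\<close> has a power in the saturation, hence in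
  \<open>H\<close>. As \<open>H\<close> is radical it contains \<open>M\<close>, and it is
  proper.\<close>

lemma radical_ideal_over_regular_saturation:
  assumes "\<And>P. primeideal P R \<Longrightarrow> regular_ideal P R \<Longrightarrow> maximalideal P R"
    and "regular_ideal I R" "radical_ideal H R" "regular_saturation R M I \<subseteq> H"
  shows "H = M"
proof -
  have H: "ideal H R" "H \<noteq> carrier R" "ideal_radical R H = H"
    using assms(3) by (simp_all add: radical_ideal_def)
  have "M \<subseteq> H"
  proof
    fix a assume a: "a \<in> M"
    then obtain n :: nat where n: "a [^] n \<in> H"
      using power_in_regular_saturation[OF assms(1,2)] assms(4) by blast
    \<comment> \<open>\<open>ideal_radical\<close> asks for a positive exponent; the exponent 0
      would put \<one> into the proper ideal \<open>H\<close>.\<close>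
    have "n \<noteq> 0"
      using n H(2) ideal.one_imp_carrier[OF H(1)] by (metis nat_pow_0)
    then have "a \<in> ideal_radical R H"
      using n a ideal_subset_carrier[OF maximalideal.axioms(1)[OF maximal]]
      by (auto simp: ideal_radical_def)
    then show "a \<in> H"
      using H(3) by simp
  qed
  then show ?thesis
    using maximalideal.I_maximal[OF maximal H(1)] H(2) ideal_subset_carrier[OF H(1)] by auto
qed

text \<open>A factor of a locally principal product is locally principal. Otherwise all products of a
  regular element of \<open>H\<close> with an element of \<open>K\<close>, hence all elements of \<open>H \<cdot> K\<close>, would be
  locally in \<open>m M\<close>, and so would \<open>m\<close> itself.\<close>

lemma locally_principal_factor:
  assumes "ideal H R" "ideal K R" "m \<in> regular_elements R" "m \<in> H \<cdot> K"
    "H \<cdot> K \<subseteq> regular_saturation R M (PIdl m)"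
  obtains t where "t \<in> regular_elements R" "t \<in> H" "H \<subseteq> regular_saturation R M (PIdl t)"
proof -
  interpret H: ideal H R by fact
  interpret K: ideal K R by fact
  interpret M: maximalideal M R by (rule maximal)
  note m = regular_elements_closed[OF assms(3)]
  \<comment> \<open>\<open>N\<close> is the contraction of the extension of \<open>m M\<close>. It
    omits \<open>m\<close>: cancelling \<open>m\<close> would put a multiplier \<open>s\<close> into
    \<open>M\<close>.\<close>
  define N where "N = regular_saturation R M {m \<otimes> c | c. c \<in> M}"
  have "ideal {m \<otimes> c | c. c \<in> M} R"
  proof (rule idealI_mult_closed)
    show "{m \<otimes> c | c. c \<in> M} \<subseteq> carrier R"
      using m M.Icarr by auto
    show "\<zero> \<in> {m \<otimes> c | c. c \<in> M}"
      using m M.zero_closed by (auto intro!: exI[of _ \<zero>])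
    show "x \<otimes> a \<in> {m \<otimes> c | c. c \<in> M}" if ax: "a \<in> {m \<otimes> c | c. c \<in> M}" "x \<in> carrier R" for a x
    proof -
      obtain c where c: "c \<in> M" "a = m \<otimes> c"
        using ax(1) by auto
      have "x \<otimes> a = m \<otimes> (x \<otimes> c)"
        using c m ax(2) M.Icarr by (simp add: m_lcomm)
      then show ?thesis
        using M.I_l_closed[OF c(1) ax(2)] by auto
    qed
    show "a \<oplus> b \<in> {m \<otimes> c | c. c \<in> M}"
      if ab: "a \<in> {m \<otimes> c | c. c \<in> M}" "b \<in> {m \<otimes> c | c. c \<in> M}" for a b
    proof -
      obtain c d where c: "c \<in> M" "a = m \<otimes> c" and d: "d \<in> M" "b = m \<otimes> d"
        using ab by auto
      have "a \<oplus> b = m \<otimes> (c \<oplus> d)"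
        using c d m M.Icarr by (simp add: r_distr)
      then show ?thesis
        using M.a_closed[OF c(1) d(1)] by auto
    qed
  qed
  then have N: "ideal N R"
    unfolding N_def by (rule regular_saturation_ideal)
  have "m \<notin> N"
  proof
    assume "m \<in> N"
    then obtain s c where s: "s \<in> regular_elements R" "s \<notin> M" "c \<in> M" "s \<otimes> m = m \<otimes> c"
      by (auto simp: N_def regular_saturation_def)
    then have "m \<otimes> s = m \<otimes> c"
      using m by (simp add: m_comm regular_elements_closed)
    then have "s = c"
      using s by (intro regular_cancel[OF assms(3), of s c]) (auto simp: regular_elements_closed M.Icarr)
    then show False
      using s by blast
  qed
  have mH: "m \<in> H" and mK: "m \<in> K"
    using assms(4) ideal_prod_inter[OF assms(1,2)] by auto
  have regH: "regular_ideal H R"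
    using mH assms(1,3) unfolding regular_ideal_def by blast
  have "\<exists>g \<in> H \<inter> regular_elements R. \<exists>k \<in> K. g \<otimes> k \<notin> N"
  proof (rule ccontr)
    assume neg: "\<not> ?thesis"
    have HK: "h \<otimes> k \<in> N" if "h \<in> H" "k \<in> K" for h k
    proof -
      interpret N: ideal N R by fact
      have k: "k \<in> carrier R"
        using that(2) by (rule K.Icarr)
      \<comment> \<open>This colon ideal contains every regular element of \<open>H\<close>, so the
        Marot property puts all of \<open>H\<close> into it.\<close>
      have "ideal {x \<in> carrier R. x \<otimes> k \<in> N} R"
        using k by (intro idealI_mult_closed)
          (auto simp: l_distr m_assoc N.zero_closed N.a_closed N.I_l_closed)
      then have "H \<subseteq> {x \<in> carrier R. x \<otimes> k \<in> N}"
        using neg that(2) H.Icarr by (intro marot_subsetI[OF marot regH]) auto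
      then show ?thesis
        using that(1) by blast
    qed
    have "z \<in> N" if "z \<in> H \<cdot> K" for z
      using that
      by induction (simp_all add: HK additive_subgroup.a_closed[OF ideal.axioms(1)[OF N]])
    then show False
      using assms(4) \<open>m \<notin> N\<close> by blast
  qed
  then obtain g k where g: "g \<in> H" "g \<in> regular_elements R" and k: "k \<in> K" "g \<otimes> k \<notin> N"
    by blast
  have cl: "g \<in> carrier R" "k \<in> carrier R"
    using g(1) k(1) H.Icarr K.Icarr by auto
  have "g \<otimes> k \<in> regular_saturation R M (PIdl m)"
    using ideal_prod.prod[OF g(1) k(1), of R] assms(5) by blast
  then obtain s where s: "s \<in> regular_elements R" "s \<notin> M" "s \<otimes> (g \<otimes> k) \<in> PIdl m"
    by (auto simp: regular_saturation_def)
  then obtain c where c: "c \<in> carrier R" "s \<otimes> (g \<otimes> k) = c \<otimes> m"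
    by (auto simp: cgenideal_def)
  \<comment> \<open>Otherwise \<open>s\<close> would witness that \<open>g \<otimes> k\<close> lies
    in \<open>N\<close>.\<close>
  have "c \<notin> M"
    using k(2) s(1,2) c m cl m_comm[of c m] by (auto simp: N_def regular_saturation_def)
  \<comment> \<open>The multiplier \<open>c\<close> may fail to be regular, so it cannot serve as a
    denominator. The ideal \<open>C\<close> of all \<open>c\<close> with
    \<open>c \<otimes> m\<close> in \<open>g K\<close> contains the regular element
    \<open>g\<close>, because \<open>m\<close> lies in \<open>K\<close>, and it is not inside
    \<open>M\<close>; the Marot property then supplies a regular replacement \<open>r\<close>
    outside \<open>M\<close>.\<close>
  define C where "C = {c \<in> carrier R. \<exists>k \<in> K. c \<otimes> m = g \<otimes> k}"
  have "ideal C R"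
  proof (rule idealI_mult_closed)
    show "C \<subseteq> carrier R"
      by (auto simp: C_def)
    show "\<zero> \<in> C"
      using m cl K.zero_closed by (auto simp: C_def intro!: bexI[of _ \<zero>])
    fix a assume "a \<in> C"
    then obtain x where a: "a \<in> carrier R" "x \<in> K" "a \<otimes> m = g \<otimes> x"
      by (auto simp: C_def)
    show "y \<otimes> a \<in> C" if y: "y \<in> carrier R" for y
    proof -
      have "y \<otimes> a \<otimes> m = g \<otimes> (y \<otimes> x)"
        using a y cl m K.Icarr by (simp add: m_assoc m_lcomm)
      then show ?thesis
        using a(1,2) y K.I_l_closed by (auto simp: C_def)
    qed
    fix b assume "b \<in> C"
    then obtain y where b: "b \<in> carrier R" "y \<in> K" "b \<otimes> m = g \<otimes> y"
      by (auto simp: C_def)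
    have "(a \<oplus> b) \<otimes> m = g \<otimes> (x \<oplus> y)"
      using a b cl m K.Icarr by (simp add: l_distr r_distr)
    then show "a \<oplus> b \<in> C"
      using a(1,2) b(1,2) K.a_closed by (auto simp: C_def)
  qed
  moreover have "g \<in> C"
    using cl mK by (auto simp: C_def)
  moreover have "c \<in> C"
  proof -
    have "c \<otimes> m = g \<otimes> (s \<otimes> k)"
      using c(2) cl s(1) by (metis m_lcomm regular_elements_closed)
    then show ?thesis
      using c(1) k(1) s(1) K.I_l_closed by (auto simp: C_def regular_elements_closed)
  qed
  ultimately have "regular_ideal C R" "\<not> C \<subseteq> M"
    using g(2) \<open>c \<notin> M\<close> by (auto simp: regular_ideal_def)
  then obtain r where "r \<in> C" and r: "r \<in> regular_elements R" "r \<notin> M"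
    using marot_subsetI[OF marot \<open>regular_ideal C R\<close> M.is_ideal] by auto
  then obtain l where l: "l \<in> K" "r \<otimes> m = g \<otimes> l"
    by (auto simp: C_def)
  note rcl = regular_elements_closed[OF r(1)] K.Icarr[OF l(1)]
  \<comment> \<open>Locally \<open>m\<close> is \<open>g \<otimes> l\<close> up to the unit
    \<open>r\<close>, and \<open>p \<otimes> l\<close> is a multiple of \<open>m\<close>. Cancelling
    \<open>m\<close> shows that \<open>q \<otimes> r\<close> carries \<open>p\<close> into the ideal
    of \<open>g\<close>.\<close>
  have "p \<in> regular_saturation R M (PIdl g)" if p: "p \<in> H" for p
  proof -
    have pcl: "p \<in> carrier R"
      using p by (rule H.Icarr)
    have "p \<otimes> l \<in> regular_saturation R M (PIdl m)"
      using ideal_prod.prod[OF p l(1), of R] assms(5) by blast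
    then obtain q where q: "q \<in> regular_elements R" "q \<notin> M" "q \<otimes> (p \<otimes> l) \<in> PIdl m"
      by (auto simp: regular_saturation_def)
    then obtain d where d: "d \<in> carrier R" "q \<otimes> (p \<otimes> l) = d \<otimes> m"
      by (auto simp: cgenideal_def)
    note qcl = regular_elements_closed[OF q(1)]
    have "m \<otimes> (q \<otimes> r \<otimes> p) = q \<otimes> p \<otimes> (r \<otimes> m)"
      using m qcl rcl(1) pcl by (simp add: m_ac)
    also have "\<dots> = g \<otimes> (q \<otimes> (p \<otimes> l))"
      unfolding l(2) using qcl rcl pcl cl by (simp add: m_ac)
    also have "\<dots> = m \<otimes> (d \<otimes> g)"
      unfolding d(2) using m d(1) cl by (simp add: m_ac)
    finally have "q \<otimes> r \<otimes> p = d \<otimes> g"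
      using qcl rcl(1) pcl d(1) cl
      by (intro regular_cancel[OF assms(3), of "q \<otimes> r \<otimes> p" "d \<otimes> g"]) simp_all
    then show ?thesis
      using d(1) pcl mult_notin[OF qcl rcl(1) q(2) r(2)] mult_regular[OF q(1) r(1)]
      by (auto simp: regular_saturation_def cgenideal_def)
  qed
  then show ?thesis
    using that g by blast
qed

text \<open>In the factorization of the saturation of \<open>PIdl x\<close>, the last radical factor
  contains the product and is therefore \<open>M\<close>. The other factors are collected in
  \<open>K\<close>, and \<open>locally_principal_factor\<close> applies with
  \<open>m = x\<close>.\<close>

lemma isp_maximal_locally_principal:
  assumes "isp_ring R"
    and "\<And>P. primeideal P R \<Longrightarrow> regular_ideal P R \<Longrightarrow> maximalideal P R"
    and "regular_ideal M R"
  obtains t where "t \<in> regular_elements R" "t \<in> M" "M \<subseteq> regular_saturation R M (PIdl t)"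
proof -
  obtain x where x: "x \<in> regular_elements R" "x \<in> M"
    using assms(3) unfolding regular_ideal_def by blast
  note xcl = regular_elements_closed[OF x(1)]
  define I where "I = regular_saturation R M (PIdl x)"
  have "PIdl x \<subseteq> M"
    using x(2) by (rule cgenideal_minimal[OF maximalideal.axioms(1)[OF maximal]])
  then have "I \<subseteq> M"
    unfolding I_def by (rule regular_saturation_subset)
  have "x \<in> I"
    unfolding I_def using subset_regular_saturation[OF cgenideal_ideal] cgenideal_self xcl by blast
  have "ideal I R"
    unfolding I_def using regular_saturation_ideal[OF cgenideal_ideal] xcl .
  have "regular_ideal (PIdl x) R" "regular_ideal I R"
    using x(1) xcl \<open>ideal I R\<close> \<open>x \<in> I\<close> cgenideal_ideal cgenideal_self
    unfolding regular_ideal_def by blast+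
  moreover have "I \<noteq> carrier R"
    using \<open>I \<subseteq> M\<close> one_notin by auto
  ultimately obtain J Hs where J: "ideal J R" and Hs: "Hs \<noteq> []" "\<forall>H \<in> set Hs. radical_ideal H R"
    and I: "I = foldl (ideal_prod R) J Hs"
    using assms(1) unfolding isp_ring_def invertible_ideal_def by blast
  obtain Hs' H where "Hs = Hs' @ [H]"
    using Hs(1) by (metis append_butlast_last_id)
  define K where "K = foldl (ideal_prod R) J Hs'"
  have "ideal (foldl (ideal_prod R) J Ls) R" if "\<forall>L \<in> set Ls. radical_ideal L R" for Ls
    using that by (induction Ls rule: rev_induct)
      (simp_all add: J ideal_prod_is_ideal radical_ideal_def)
  then have K: "ideal K R"
    using Hs(2) unfolding K_def \<open>Hs = Hs' @ [H]\<close> by simp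
  have H: "radical_ideal H R" "ideal H R"
    using Hs(2) unfolding \<open>Hs = Hs' @ [H]\<close> by (simp_all add: radical_ideal_def)
  have "I = K \<cdot> H"
    unfolding I K_def \<open>Hs = Hs' @ [H]\<close> by simp
  then have "I = H \<cdot> K"
    using ideal_prod_commute[OF K H(2)] by simp
  then have "I \<subseteq> H"
    using ideal_prod_inter[OF H(2) K] by blast
  then have "H = M"
    using radical_ideal_over_regular_saturation[OF assms(2) \<open>regular_ideal (PIdl x) R\<close> H(1)]
    unfolding I_def by blast
  then show ?thesis
    using locally_principal_factor[OF H(2) K x(1)] \<open>x \<in> I\<close> \<open>I = H \<cdot> K\<close> that
    unfolding I_def by blast
qed

end

section \<open>The regular localization\<close>

lemma carrier_regular_localization:
  "carrier (regular_localization R M) =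
    {fraction R a b | a b. a \<in> carrier R \<and> b \<in> regular_elements R \<and> b \<notin> M}"
  by (simp add: regular_localization_def)

lemma regular_localization_simps [simp]:
  "x \<otimes>\<^bsub>regular_localization R M\<^esub> y = x \<otimes>\<^bsub>total_quotient_ring R\<^esub> y"
  "\<one>\<^bsub>regular_localization R M\<^esub> = fraction R \<one>\<^bsub>R\<^esub> \<one>\<^bsub>R\<^esub>"
  "\<zero>\<^bsub>regular_localization R M\<^esub> = fraction R \<zero>\<^bsub>R\<^esub> \<one>\<^bsub>R\<^esub>"
  by (simp_all add: regular_localization_def total_quotient_ring_def)

section \<open>Ring structure, regular elements and generator of the localization\<close>

context regular_maximal
begin

abbreviation "localization \<equiv> regular_localization R M"

lemma fraction_in_localization:
  assumes "a \<in> carrier R" "b \<in> regular_elements R" "b \<notin> M"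
  shows "fraction R a b \<in> carrier localization"
  using assms by (auto simp: carrier_regular_localization)

lemma localization_cases:
  assumes "x \<in> carrier localization"
  obtains a b where "x = fraction R a b" "a \<in> carrier R" "b \<in> regular_elements R" "b \<notin> M"
  using assms by (auto simp: carrier_regular_localization)

lemma localization_cring: "cring localization"
proof -
  let ?T = "total_quotient_ring R"
  let ?X = "{fraction R a b | a b. a \<in> carrier R \<and> b \<in> regular_elements R \<and> b \<notin> M}"
  interpret T: cring ?T
    by (rule total_quotient_ring_cring)
  have X: "?X \<subseteq> carrier ?T"
    using fraction_closed by auto
  have mem: "fraction R a b \<in> ?X" if "a \<in> carrier R" "b \<in> regular_elements R" "b \<notin> M" for a b
    using that by auto
  have minus: "\<ominus>\<^bsub>?T\<^esub> fraction R a b = fraction R (\<ominus> a) b"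
    if "a \<in> carrier R" "b \<in> regular_elements R" for a b
  proof (rule T.minus_equality)
    show "fraction R (\<ominus> a) b \<oplus>\<^bsub>?T\<^esub> fraction R a b = \<zero>\<^bsub>?T\<^esub>"
      using that regular_elements_closed[OF that(2)]
      by (simp add: fraction_add zero_total_quotient_ring fraction_eq_iff one_regular mult_regular
          l_minus l_neg)
  qed (use that fraction_closed in auto)
  have "subring ?X ?T"
  proof (rule T.subringI[OF X])
    show "\<one>\<^bsub>?T\<^esub> \<in> ?X"
      unfolding one_total_quotient_ring using one_regular one_notin by (intro mem) simp_all
    fix x assume "x \<in> ?X"
    then obtain a b where x: "x = fraction R a b" "a \<in> carrier R" "b \<in> regular_elements R" "b \<notin> M"
      by auto
    note b = regular_elements_closed[OF x(3)]
    show "\<ominus>\<^bsub>?T\<^esub> x \<in> ?X"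
      unfolding x(1) minus[OF x(2,3)] using x by (intro mem) simp_all
    fix y assume "y \<in> ?X"
    then obtain c d where y: "y = fraction R c d" "c \<in> carrier R" "d \<in> regular_elements R" "d \<notin> M"
      by auto
    note d = regular_elements_closed[OF y(3)]
    have bd: "b \<otimes> d \<in> regular_elements R" "b \<otimes> d \<notin> M"
      using x y b d by (simp_all add: mult_regular mult_notin)
    show "x \<otimes>\<^bsub>?T\<^esub> y \<in> ?X"
      unfolding x(1) y(1) fraction_mult[OF x(2,3) y(2,3)] using x y bd by (intro mem) simp_all
    show "x \<oplus>\<^bsub>?T\<^esub> y \<in> ?X"
      unfolding x(1) y(1) fraction_add[OF x(2,3) y(2,3)] using x y b d bd by (intro mem) simp_all
  qed
  then have "subcring ?X ?T"
    by (rule T.subcringI')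
  then show ?thesis
    using T.subcring_iff[OF X] by (simp add: regular_localization_def)
qed

lemma fraction_regular_in_localization:
  assumes "a \<in> regular_elements R" "b \<in> regular_elements R" "b \<notin> M"
  shows "fraction R a b \<in> regular_elements localization"
proof -
  note a = regular_elements_closed[OF assms(1)] and b = regular_elements_closed[OF assms(2)]
  have "x = \<zero>\<^bsub>localization\<^esub>"
    if x: "x \<in> carrier localization" "fraction R a b \<otimes>\<^bsub>localization\<^esub> x = \<zero>\<^bsub>localization\<^esub>" for x
  proof -
    obtain c d where c: "x = fraction R c d" "c \<in> carrier R" "d \<in> regular_elements R" "d \<notin> M"
      using x(1) by (rule localization_cases)
    have "fraction R (a \<otimes> c) (b \<otimes> d) = fraction R \<zero> \<one>"
      using x(2) c a assms(2) by (simp add: fraction_mult)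
    then have "a \<otimes> c = \<zero>"
      using a c assms(2) b by (simp add: fraction_eq_iff mult_regular one_regular regular_elements_closed)
    then have "c = \<zero>"
      using assms(1) c(2) by (simp add: regular_elements_def)
    then show ?thesis
      using c(3) by (simp add: c(1) fraction_eq_iff one_regular regular_elements_closed)
  qed
  then show ?thesis
    using fraction_in_localization[OF a assms(2,3)] by (simp add: regular_elements_def)
qed

text \<open>Regularity passes down by testing against the fractions
  \<open>fraction R x \<one>\<close>. It lets facts about regular elements of \<open>R\<close> be
  applied to numerators.\<close>

lemma regular_in_localization_iff:
  assumes "a \<in> carrier R" "b \<in> regular_elements R" "b \<notin> M"
  shows "fraction R a b \<in> regular_elements localization \<longleftrightarrow> a \<in> regular_elements R"
proof
  assume reg: "fraction R a b \<in> regular_elements localization"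
  note b = regular_elements_closed[OF assms(2)]
  have "x = \<zero>" if x: "x \<in> carrier R" "a \<otimes> x = \<zero>" for x
  proof -
    have "fraction R x \<one> \<in> carrier localization"
      using x(1) one_regular one_notin by (rule fraction_in_localization)
    moreover have "fraction R a b \<otimes>\<^bsub>localization\<^esub> fraction R x \<one> = \<zero>\<^bsub>localization\<^esub>"
      using x assms b by (simp add: fraction_mult one_regular fraction_eq_iff)
    ultimately have "fraction R x \<one> = \<zero>\<^bsub>localization\<^esub>"
      using reg unfolding regular_elements_def by blast
    then show ?thesis
      using x(1) by (simp add: fraction_eq_iff one_regular)
  qed
  then show "a \<in> regular_elements R"
    using assms(1) by (simp add: regular_elements_def)
qed (use assms fraction_regular_in_localization in blast)

lemma localization_pow:
  assumes "a \<in> carrier R"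
  shows "fraction R a \<one> [^]\<^bsub>localization\<^esub> (n::nat) = fraction R (a [^] n) \<one>"
proof -
  interpret B: cring localization
    by (rule localization_cring)
  show ?thesis
    using assms by (induction n) (simp_all add: fraction_mult one_regular)
qed

text \<open>Primeness of the ideal of \<open>t\<close> is inherited from \<open>M\<close> through
  \<open>mem_iff\<close>. For a regular fraction, the ideal of its numerator is regular, so its
  saturation contains a power of \<open>t\<close>.\<close>

lemma adic_cring_localization:
  assumes "\<And>P. primeideal P R \<Longrightarrow> regular_ideal P R \<Longrightarrow> maximalideal P R"
    and "t \<in> regular_elements R" "t \<in> M" "M \<subseteq> regular_saturation R M (PIdl t)"
  shows "adic_cring localization (fraction R t \<one>)"
proof -
  interpret B: cring localization
    by (rule localization_cring)
  let ?t = "fraction R t \<one>"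
  note t = regular_elements_closed[OF assms(2)]
  have tB: "?t \<in> carrier localization"
    using t one_regular one_notin by (rule fraction_in_localization)
  interpret M: ideal M R
    using maximal by (rule maximalideal.axioms(1))
  \<comment> \<open>The ideal generated by \<open>t\<close> in the localization is exactly the
    extension of \<open>M\<close>, and membership depends on the numerator alone.\<close>
  have mem_iff: "fraction R a b \<in> PIdl\<^bsub>localization\<^esub> ?t \<longleftrightarrow> a \<in> M"
    if a: "a \<in> carrier R" "b \<in> regular_elements R" "b \<notin> M" for a b
  proof
    note b = regular_elements_closed[OF a(2)]
    assume "fraction R a b \<in> PIdl\<^bsub>localization\<^esub> ?t"
    then obtain x where x: "x \<in> carrier localization" "fraction R a b = ?t \<otimes>\<^bsub>localization\<^esub> x"
      using B.mem_cgenideal_iff[OF tB] by auto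
    obtain c d where c: "x = fraction R c d" "c \<in> carrier R" "d \<in> regular_elements R" "d \<notin> M"
      using x(1) by (rule localization_cases)
    have "a \<otimes> d = t \<otimes> c \<otimes> b"
      using x(2) a c t by (simp add: fraction_mult one_regular fraction_eq_iff regular_elements_closed)
    also have "\<dots> \<in> M"
      using assms(3) b c(2) by (simp add: M.I_r_closed)
    finally show "a \<in> M"
      using mult_notin[of a d] a(1) c(3,4) regular_elements_closed[OF c(3)] by auto
  next
    note b = regular_elements_closed[OF a(2)]
    assume "a \<in> M"
    then obtain s where s: "s \<in> regular_elements R" "s \<notin> M" "s \<otimes> a \<in> PIdl t"
      using assms(4) by (auto simp: regular_saturation_def)
    note scl = regular_elements_closed[OF s(1)]
    obtain c where c: "c \<in> carrier R" "s \<otimes> a = t \<otimes> c"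
      using s(3) mem_cgenideal_iff[OF t] by auto
    have sb: "s \<otimes> b \<in> regular_elements R" "s \<otimes> b \<notin> M"
      using s(1,2) a(2,3) scl b by (simp_all add: mult_regular mult_notin)
    have "a \<otimes> (s \<otimes> b) = (s \<otimes> a) \<otimes> b"
      using a(1) scl b by (simp add: m_ac)
    then have "fraction R a b = ?t \<otimes>\<^bsub>localization\<^esub> fraction R c (s \<otimes> b)"
      using a sb c t scl b by (simp add: fraction_mult one_regular fraction_eq_iff)
    then show "fraction R a b \<in> PIdl\<^bsub>localization\<^esub> ?t"
      using B.mem_cgenideal_iff[OF tB] fraction_in_localization[OF c(1) sb] by auto
  qed
  show ?thesis
  proof (intro adic_cring.intro adic_cring_axioms.intro localization_cring)
    show "?t \<in> regular_elements localization"
      using assms(2) one_regular one_notin by (rule fraction_regular_in_localization)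
    show "primeideal (PIdl\<^bsub>localization\<^esub> ?t) localization"
    proof (rule primeidealI[OF B.cgenideal_ideal[OF tB] localization_cring])
      show "carrier localization \<noteq> PIdl\<^bsub>localization\<^esub> ?t"
        using mem_iff[of \<one> \<one>] fraction_in_localization[of \<one> \<one>] one_regular one_notin by auto
      fix x y
      assume xy: "x \<in> carrier localization" "y \<in> carrier localization"
        "x \<otimes>\<^bsub>localization\<^esub> y \<in> PIdl\<^bsub>localization\<^esub> ?t"
      obtain a b where x: "x = fraction R a b" "a \<in> carrier R" "b \<in> regular_elements R" "b \<notin> M"
        using xy(1) by (rule localization_cases)
      obtain c d where y: "y = fraction R c d" "c \<in> carrier R" "d \<in> regular_elements R" "d \<notin> M"
        using xy(2) by (rule localization_cases)
      have "b \<otimes> d \<in> regular_elements R" "b \<otimes> d \<notin> M"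
        using x y by (simp_all add: mult_regular mult_notin regular_elements_closed)
      then have "a \<otimes> c \<in> M"
        using xy(3) x y mem_iff[of "a \<otimes> c" "b \<otimes> d"] by (simp add: fraction_mult)
      then show "x \<in> PIdl\<^bsub>localization\<^esub> ?t \<or> y \<in> PIdl\<^bsub>localization\<^esub> ?t"
        using mult_notin[OF x(2) y(2)] x y mem_iff[OF x(2-4)] mem_iff[OF y(2-4)] by auto
    qed
    fix z assume z: "z \<in> regular_elements localization"
    obtain a b where a: "z = fraction R a b" "a \<in> carrier R" "b \<in> regular_elements R" "b \<notin> M"
      using localization_cases[OF regular_elements_closed[OF z]] by auto
    note b = regular_elements_closed[OF a(3)]
    have "a \<in> regular_elements R"
      using z regular_in_localization_iff[OF a(2-4)] a(1) by simp
    then have "regular_ideal (PIdl a) R"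
      using cgenideal_ideal[OF a(2)] cgenideal_self[OF a(2)] by (auto simp: regular_ideal_def)
    then obtain n :: nat where "t [^] n \<in> regular_saturation R M (PIdl a)"
      using power_in_regular_saturation[OF assms(1) _ assms(3)] by auto
    then obtain s where s: "s \<in> regular_elements R" "s \<notin> M" "s \<otimes> t [^] n \<in> PIdl a"
      by (auto simp: regular_saturation_def)
    note scl = regular_elements_closed[OF s(1)]
    obtain c where c: "c \<in> carrier R" "s \<otimes> t [^] n = a \<otimes> c"
      using s(3) mem_cgenideal_iff[OF a(2)] by auto
    \<comment> \<open>This is the cross-multiplied form of the factorization of the power of
      \<open>t\<close> as \<open>z\<close> times the fraction of \<open>b \<otimes> c\<close> over
      \<open>s\<close>.\<close>
    have "t [^] n \<otimes> (b \<otimes> s) = b \<otimes> (s \<otimes> t [^] n)"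
      using t scl b by (simp add: m_ac)
    also have "\<dots> = a \<otimes> (b \<otimes> c)"
      unfolding c(2) using a(2) b c(1) by (simp add: m_ac)
    finally have "?t [^]\<^bsub>localization\<^esub> n = z \<otimes>\<^bsub>localization\<^esub> fraction R (b \<otimes> c) s"
      using a s(1) b c(1) t scl
      by (simp add: localization_pow fraction_mult fraction_eq_iff one_regular mult_regular)
    moreover have "fraction R (b \<otimes> c) s \<in> carrier localization"
      using b c(1) s(1,2) by (simp add: fraction_in_localization)
    ultimately show "\<exists>n::nat. ?t [^]\<^bsub>localization\<^esub> n \<in> PIdl\<^bsub>localization\<^esub> z"
      using B.mem_cgenideal_iff regular_elements_closed[OF z] by auto
  qed
qed

end

theorem theorem3p6:
  fixes A :: "('a, 'm) ring_scheme"
  assumes "nonzero_cring A"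
    and "marot_ring A"
    and "isp_ring A"
    and "\<And>P. primeideal P A \<Longrightarrow> regular_ideal P A \<Longrightarrow> maximalideal P A"
  shows "n_ring A"
  unfolding n_ring_def
proof (intro allI impI, elim conjE)
  fix M assume M: "maximalideal M A" "regular_ideal M A"
  have "cring A"
    using assms(1) by (simp add: nonzero_cring_def)
  then interpret regular_maximal A M
    using M(1) assms(2) by (simp add: regular_maximal_def regular_maximal_axioms_def)
  obtain t where "t \<in> regular_elements A" "t \<in> M" "M \<subseteq> regular_saturation A M (PIdl\<^bsub>A\<^esub> t)"
    using assms(3,4) M(2) by (rule isp_maximal_locally_principal)
  then have "adic_cring localization (fraction A t \<one>\<^bsub>A\<^esub>)"
    using assms(4) by (intro adic_cring_localization)
  then show "discrete_rank_one_manis_valuation_ring localization"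
    by (rule adic_cring.discrete_rank_one)
qed

end
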